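(* Fix positive integers $m$ and $n$, and let $\pi\in\{0,1\}$ be the remainder of $n$ modulo $2$. Let $\mathrm c=(c_0,\dots,c_n)$ be a $1$-free child sequence with $c_0=0$, and let $\mathrm b=(b_0,\dots,b_{n+\pi})$ be a binary child sequence with $b_0=0$, such that $\mathcal T_{\mathrm c}$ and $\mathcal T_{\mathrm b}$ are nonempty. Let $(\mathbf T,\mathbf P)$ be uniformly random in $\{(T,P):T\in\mathcal T_{\mathrm c},\,P\in\mathcal P_{m,\operatorname{ht}_T(0)}\}$ and let $(\mathbf S,\mathbf Q)$ be uniformly random in $\{(S,Q):S\in\mathcal T_{\mathrm b},\,Q\in\mathcal P_{m,\operatorname{ht}_S(0)}\}$. Then $\operatorname{ht}_{\mathbf T}(0)\preceq_{\mathrm{st}}\operatorname{ht}_{\mathbf S}(0)$.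
   Context: A child sequence is a finite sequence $\mathrm c=(c_v,v\in V)$ of nonnegative integers with $\sum_{v\in V}c_v\le|V|-1$; here $(c_0,\dots,c_n)$ is indexed by $V=\{0,1,\dots,n\}$. It is $1$-free if no entry equals $1$, and binary if every entry is $0$ or $2$. $\mathcal T_{\mathrm c}$ is the set of rooted (labeled) trees with vertex set $V$ in which each $v\in V$ has exactly $c_v$ children (nonempty only if $\sum_v c_v=|V|-1$). $\operatorname{ht}_T(v)$ is the graph distance from the root of $T$ to $v$. For integers $m\ge1$, $h\ge0$, $\mathcal P_{m,h}$ is the set of sequences of $m$ nonnegative integers summing to $h$. $X\preceq_{\mathrm{st}}Y$ means $\mathbb P(X\ge x)\le\mathbb P(Y\ge x)$ for all real $x$. *)

theory Defs
  imports "HOL-Probability.Probability"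
begin

(* A simple graph on V is encoded by its adjacency relation E, which contains both
   orientations of every edge. *)
definition simple_graph_on :: "'a set \<Rightarrow> 'a rel \<Rightarrow> bool" where
  "simple_graph_on V E \<longleftrightarrow> E \<subseteq> V \<times> V \<and> sym E \<and> irrefl E"

definition is_cycle :: "'a rel \<Rightarrow> 'a list \<Rightarrow> bool" where
  "is_cycle E p \<longleftrightarrow> 3 \<le> length p \<and> distinct p \<and>
     (\<forall>i<length p. (p ! i, p ! (Suc i mod length p)) \<in> E)"

definition tree_on :: "'a set \<Rightarrow> 'a rel \<Rightarrow> bool" where
  "tree_on V E \<longleftrightarrow> simple_graph_on V E \<and> (\<forall>u\<in>V. \<forall>v\<in>V. (u, v) \<in> E\<^sup>*) \<and> (\<nexists>p. is_cycle E p)"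

(* A pair is in the k-th relational power of E iff a walk of length k joins its
   components; the value is unspecified if there is no walk from u to v. *)
definition graph_dist :: "'a rel \<Rightarrow> 'a \<Rightarrow> 'a \<Rightarrow> nat" where
  "graph_dist E u v = (LEAST k. (u, v) \<in> E ^^ k)"

record 'a rooted_graph =
  tedges :: "'a rel"
  troot :: 'a

definition rooted_tree_on :: "'a set \<Rightarrow> 'a rooted_graph \<Rightarrow> bool" where
  "rooted_tree_on V T \<longleftrightarrow> tree_on V (tedges T) \<and> troot T \<in> V"

definition ht :: "'a rooted_graph \<Rightarrow> 'a \<Rightarrow> nat" where
  "ht T v = graph_dist (tedges T) (troot T) v"

definition children :: "'a rooted_graph \<Rightarrow> 'a \<Rightarrow> 'a set" where
  "children T v = {w. (v, w) \<in> tedges T \<and> ht T w = ht T v + 1}"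

(* The bound is stated over the integers because card V - 1 would truncate for empty V.
   The values of c outside V play no role, here and below. *)
definition child_sequence :: "'a set \<Rightarrow> ('a \<Rightarrow> nat) \<Rightarrow> bool" where
  "child_sequence V c \<longleftrightarrow> finite V \<and> int (\<Sum>v\<in>V. c v) \<le> int (card V) - 1"

definition one_free_seq :: "'a set \<Rightarrow> ('a \<Rightarrow> nat) \<Rightarrow> bool" where
  "one_free_seq V c \<longleftrightarrow> (\<forall>v\<in>V. c v \<noteq> 1)"

definition binary_seq :: "'a set \<Rightarrow> ('a \<Rightarrow> nat) \<Rightarrow> bool" where
  "binary_seq V c \<longleftrightarrow> (\<forall>v\<in>V. c v = 0 \<or> c v = 2)"

definition trees_of :: "'a set \<Rightarrow> ('a \<Rightarrow> nat) \<Rightarrow> 'a rooted_graph set" where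
  "trees_of V c = {T. rooted_tree_on V T \<and> (\<forall>v\<in>V. card (children T v) = c v)}"

definition weak_compositions :: "nat \<Rightarrow> nat \<Rightarrow> nat list set" where
  "weak_compositions m h = {P. length P = m \<and> sum_list P = h}"

definition marked_trees ::
    "nat \<Rightarrow> 'a set \<Rightarrow> ('a \<Rightarrow> nat) \<Rightarrow> 'a \<Rightarrow> ('a rooted_graph \<times> nat list) set" where
  "marked_trees m V c v = {(T, P). T \<in> trees_of V c \<and> P \<in> weak_compositions m (ht T v)}"

definition stoch_le :: "real pmf \<Rightarrow> real pmf \<Rightarrow> bool" (infix \<open>\<preceq>\<^sub>s\<^sub>t\<close> 50) where
  "X \<preceq>\<^sub>s\<^sub>t Y \<longleftrightarrow> (\<forall>x. measure_pmf.prob X {x..} \<le> measure_pmf.prob Y {x..})"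

(* pmf_of_set is the uniform distribution only on finite nonempty sets. *)
lemma finite_trees_of:
  assumes "finite V"
  shows "finite (trees_of V c)"
proof (rule finite_subset)
  show "trees_of V c \<subseteq> (\<lambda>(E, r). \<lparr>tedges = E, troot = r\<rparr>) ` (Pow (V \<times> V) \<times> V)"
  proof
    fix T assume T: "T \<in> trees_of V c"
    have "T = (\<lambda>(E, r). \<lparr>tedges = E, troot = r\<rparr>) (tedges T, troot T)"
      by simp
    moreover have "(tedges T, troot T) \<in> Pow (V \<times> V) \<times> V"
      using T by (auto simp: trees_of_def rooted_tree_on_def tree_on_def simple_graph_on_def)
    ultimately show "T \<in> (\<lambda>(E, r). \<lparr>tedges = E, troot = r\<rparr>) ` (Pow (V \<times> V) \<times> V)"
      by (rule image_eqI)
  qed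
  show "finite ((\<lambda>(E, r). \<lparr>tedges = E, troot = r\<rparr>) ` (Pow (V \<times> V) \<times> V))"
    using assms by auto
qed

lemma finite_weak_compositions: "finite (weak_compositions m h)"
proof (rule finite_subset)
  show "weak_compositions m h \<subseteq> {P. set P \<subseteq> {..h} \<and> length P = m}"
    by (auto simp: weak_compositions_def member_le_sum_list)
  show "finite {P. set P \<subseteq> {..h} \<and> length P = m}"
    by (rule finite_lists_length_eq) simp
qed

lemma finite_marked_trees:
  assumes "finite V"
  shows "finite (marked_trees m V c v)"
proof -
  have "marked_trees m V c v = (SIGMA T:trees_of V c. weak_compositions m (ht T v))"
    by (auto simp: marked_trees_def)
  then show ?thesis
    using assms by (simp add: finite_SigmaI finite_trees_of finite_weak_compositions)
qed

lemma marked_trees_nonempty: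
  assumes "0 < m" and "trees_of V c \<noteq> {}"
  shows "marked_trees m V c v \<noteq> {}"
proof -
  obtain T where T: "T \<in> trees_of V c"
    using assms(2) by blast
  have "ht T v # replicate (m - 1) 0 \<in> weak_compositions m (ht T v)"
    using assms(1) by (simp add: weak_compositions_def sum_list_replicate)
  then show ?thesis
    using T by (auto simp: marked_trees_def)
qed

end

theory Submission
  imports Defs
begin

text \<open>The law of the height of the vertex 0 has a closed form, and the two laws turn out to have a monotone
likelihood ratio, which is stronger than stochastic order.

Count the trees with child counts \<open>c\<close> on \<open>n + 1\<close> vertices in which the leaf \<open>z\<close> has height \<open>h\<close> by
their spine, the path from the root to \<open>z\<close>. Once the \<open>h\<close> proper ancestors of \<open>z\<close> and their order are
chosen, cutting the spine leaves a forest whose roots are the spine vertices, with one child less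
at each ancestor. The number of forests with given roots and child counts is classical and is found
by deleting leaves (\<open>card_forests\<close>). For a sequence without ones this gives the number
\<open>h! * (n - 1 - h)! * E h\<close>, up to the constant factor \<open>1 / (\<Prod>v. (c v)!)\<close>, where \<open>E h\<close> is the sum of
\<open>(\<Sum>v\<in>A. c v - 1) * (\<Prod>v\<in>A. c v)\<close> over the sets \<open>A\<close> of \<open>h\<close> vertices other than \<open>z\<close>
(\<open>card_trees_of_height_spine_sum\<close>).

Removing one element from sets of size \<open>h + 1\<close> shows that \<open>h * E (h + 1)\<close> is the same sum as \<open>E h\<close>, but
with the additional factor \<open>n - (\<Sum>v\<in>A. c v)\<close> (\<open>spine_sum_Suc\<close>). A set \<open>A\<close> contributes only if
none of its elements is a leaf, so without ones this factor is at most \<open>n - 2 * h\<close>, and it equals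
\<open>n - 2 * h\<close> for binary sequences. The consecutive ratios \<open>E (h + 1) / E h\<close> are thus largest for binary
sequences. If \<open>n\<close> is even, the factorials are the same for both kinds of trees. If \<open>n\<close> is odd,
the binary trees have one more vertex, and the comparison becomes
\<open>(n - 2 * h) * (n - h) \<le> (n - 1 - h) * (n + 1 - 2 * h)\<close>, that is \<open>1 \<le> h\<close>, which holds since 0 is a leaf
and not the root. Marking a tree of height \<open>h\<close> multiplies its count by a number that depends on \<open>h\<close> and
\<open>m\<close> only and cancels in the comparison of the two laws.\<close>

section \<open>Rooted forests as parent maps\<close>

inductive reaches :: "('a \<Rightarrow> 'a) \<Rightarrow> 'a set \<Rightarrow> 'a \<Rightarrow> bool" for p R where
  here: "x \<in> R \<Longrightarrow> reaches p R x"
| climb: "reaches p R (p x) \<Longrightarrow> reaches p R x"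

text \<open>A rooted forest on \<open>V\<close> with root set \<open>R\<close>, in which \<open>v\<close> has \<open>c v\<close> children, is encoded by
its parent map. Fixing every point outside \<open>V - R\<close> makes the map of a given forest unique, so
that the number of maps is the number of forests; reaching the roots excludes cycles.\<close>
definition forests :: "'a set \<Rightarrow> 'a set \<Rightarrow> ('a \<Rightarrow> nat) \<Rightarrow> ('a \<Rightarrow> 'a) set" where
  "forests V R c = {p. (\<forall>x. x \<notin> V - R \<longrightarrow> p x = x) \<and>
     (\<forall>x\<in>V - R. p x \<in> V \<and> reaches p R x) \<and>
     (\<forall>v\<in>V. card {w \<in> V - R. p w = v} = c v)}"

lemma finite_forests:
  assumes "finite V"
  shows "finite (forests V R c)"
proof (rule finite_imageD)
  have "(\<lambda>p. restrict p (V - R)) ` forests V R c \<subseteq> (V - R) \<rightarrow>\<^sub>E V"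
    by (rule image_subsetI) (simp only: restrict_PiE_iff, simp add: forests_def)
  then show "finite ((\<lambda>p. restrict p (V - R)) ` forests V R c)"
    using assms by (meson finite_PiE finite_subset finite_Diff)
  show "inj_on (\<lambda>p. restrict p (V - R)) (forests V R c)"
  proof (rule inj_onI, rule ext)
    fix p q x
    assume "p \<in> forests V R c" "q \<in> forests V R c" "restrict p (V - R) = restrict q (V - R)"
    then show "p x = q x"
      unfolding forests_def by (cases "x \<in> V - R") (auto dest: fun_cong[where x = x])
  qed
qed

lemma sum_child_counts:
  assumes "finite V" and p: "p \<in> forests V R c"
  shows "(\<Sum>v\<in>V. c v) = card (V - R)"
proof -
  have "(\<Sum>v\<in>V. c v) = (\<Sum>v\<in>V. card {w \<in> V - R. p w = v})"
    using p by (simp add: forests_def)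
  also have "\<dots> = card (\<Union>v\<in>V. {w \<in> V - R. p w = v})"
    using assms(1) by (subst card_UN_disjoint) auto
  also have "(\<Union>v\<in>V. {w \<in> V - R. p w = v}) = V - R"
    using p by (auto simp: forests_def)
  finally show ?thesis .
qed

text \<open>Deleting a leaf \<open>w\<close> that is not a root leaves a forest on \<open>V - {w}\<close> in which the parent of \<open>w\<close>
has lost one child, and conversely a new leaf may be attached anywhere. This is the recursion
behind the count of all forests.\<close>
lemma parent_of_leaf:
  assumes "finite V" "R \<subseteq> V" and w: "w \<in> V - R" "c w = 0"
  shows "p \<in> forests V R c \<longleftrightarrow>
    p w \<in> {u \<in> V - {w}. 0 < c u} \<and>
    p(w := w) \<in> forests (V - {w}) R (c(p w := c (p w) - 1))"
proof
  assume p: "p \<in> forests V R c"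
  have out: "p x = x" if "x \<notin> V - R" for x using p that by (auto simp: forests_def)
  have inV: "p x \<in> V" and reach: "reaches p R x" if "x \<in> V - R" for x
    using p that by (auto simp: forests_def)
  have cnt: "card {x \<in> V - R. p x = v} = c v" if "v \<in> V" for v
    using p that by (auto simp: forests_def)
  have fin: "finite {x \<in> V - R. p x = v}" for v using assms(1) by auto
  have "{x \<in> V - R. p x = w} = {}"
    using cnt[of w] w fin[of w] by (metis (no_types, lifting) DiffD1 card_0_eq)
  then have nw: "p x \<noteq> w" if "x \<in> V - R" for x using that by auto
  have "{x \<in> V - R. p x = p w} \<noteq> {}" using w by auto
  then have pos: "0 < c (p w)"
    using cnt[of "p w"] inV[of w] w fin[of "p w"] by (metis (no_types, lifting) card_gt_0_iff)
  have r: "x = w \<or> reaches (p(w := w)) R x" if "reaches p R x" "x \<in> V" for x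
    using that
  proof induction
    case (here x) then show ?case by (auto intro: reaches.here)
  next
    case (climb x)
    show ?case
    proof (cases "x \<in> R \<or> x = w")
      case True then show ?thesis by (auto intro: reaches.here)
    next
      case False
      then have x: "x \<in> V - R" "x \<noteq> w" using climb.prems by auto
      have "reaches (p(w := w)) R (p x)" using climb.IH inV[of x] nw[of x] x by (auto simp: fun_upd_def)
      then have "reaches (p(w := w)) R ((p(w := w)) x)" using x by simp
      then show ?thesis by (blast intro: reaches.climb)
    qed
  qed
  have cnt': "card {x \<in> V - {w} - R. (p(w := w)) x = v} = (c(p w := c (p w) - 1)) v"
    if v: "v \<in> V - {w}" for v
  proof -
    have "{x \<in> V - {w} - R. (p(w := w)) x = v} = {x \<in> V - R. p x = v} - {w}"
      by auto
    then show ?thesis using cnt[of v] v w fin[of v]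
      by (cases "p w = v") (auto simp: card_Diff_singleton_if)
  qed
  have "p(w := w) \<in> forests (V - {w}) R (c(p w := c (p w) - 1))"
    unfolding forests_def mem_Collect_eq
  proof (intro conjI ballI allI impI)
    fix x assume "x \<notin> V - {w} - R" then show "(p(w := w)) x = x" using out by auto
  next
    fix x assume "x \<in> V - {w} - R" then show "(p(w := w)) x \<in> V - {w}"
      using inV[of x] nw[of x] by auto
  next
    fix x assume "x \<in> V - {w} - R" then show "reaches (p(w := w)) R x"
      using r[OF reach[of x]] by auto
  next
    fix v assume "v \<in> V - {w}" then show "card {x \<in> V - {w} - R. (p(w := w)) x = v} = (c(p w := c (p w) - 1)) v"
      by (rule cnt')
  qed
  then show "p w \<in> {u \<in> V - {w}. 0 < c u} \<and>
    p(w := w) \<in> forests (V - {w}) R (c(p w := c (p w) - 1))"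
    using pos inV[of w] w by auto
next
  assume H: "p w \<in> {u \<in> V - {w}. 0 < c u} \<and>
    p(w := w) \<in> forests (V - {w}) R (c(p w := c (p w) - 1))"
  then have pw: "p w \<in> V" "p w \<noteq> w" "0 < c (p w)" by auto
  let ?q = "p(w := w)"
  have q: "?q \<in> forests (V - {w}) R (c(p w := c (p w) - 1))" using H by simp
  have out: "p x = x" if "x \<notin> V - R" for x
  proof -
    have "x \<noteq> w" using that w by auto
    moreover have "?q x = x" using q that by (auto simp: forests_def)
    ultimately show ?thesis by simp
  qed
  have inV: "p x \<in> V" "p x \<noteq> w" and reach: "reaches ?q R x" if "x \<in> V - {w} - R" for x
    using q that by (auto simp: forests_def split: if_splits)
  have fin: "finite {x \<in> V - R. p x = v}" for v using assms(1) by auto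
  have r: "reaches p R x" if "reaches ?q R x" "x \<in> V - {w}" for x
    using that
  proof induction
    case (here x) then show ?case by (auto intro: reaches.here)
  next
    case (climb x)
    show ?case
    proof (cases "x \<in> R")
      case True then show ?thesis by (auto intro: reaches.here)
    next
      case False
      then show ?thesis using climb inV[of x] by (auto intro: reaches.climb)
    qed
  qed
  have r': "reaches p R x" if "x \<in> V - {w}" for x
    using r reach[of x] that by (cases "x \<in> R") (auto intro: reaches.here)
  have cnt: "card {x \<in> V - R. p x = v} = c v" if v: "v \<in> V" for v
  proof (cases "v = w")
    case True
    have "p x \<noteq> w" if "x \<in> V - R" for x
      using inV(2)[of x] pw(2) that by (cases "x = w") auto
    then have "{x \<in> V - R. p x = w} = {}" by blast
    then show ?thesis using True w(2) by (simp only: card.empty)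
  next
    case False
    then have c1: "card {x \<in> V - {w} - R. ?q x = v} = (c(p w := c (p w) - 1)) v"
      using q v by (auto simp: forests_def)
    have eq: "{x \<in> V - R. p x = v} =
       (if p w = v then insert w {x \<in> V - {w} - R. ?q x = v} else {x \<in> V - {w} - R. ?q x = v})"
      using w by auto
    have "finite {x \<in> V - {w} - R. ?q x = v}" using assms(1) by auto
    then show ?thesis unfolding eq using c1 pw by (auto simp del: fun_upd_apply simp: fun_upd_same fun_upd_other)
  qed
  show "p \<in> forests V R c"
    unfolding forests_def mem_Collect_eq
  proof (intro conjI ballI allI impI)
    fix x assume "x \<notin> V - R" then show "p x = x" by (rule out)
  next
    fix x assume "x \<in> V - R" then show "p x \<in> V"
      using inV(1)[of x] pw by auto
  next
    fix x assume "x \<in> V - R" then show "reaches p R x"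
      using r'[of x] reaches.climb[OF r'[of "p w"]] pw by auto
  next
    fix v assume "v \<in> V" then show "card {x \<in> V - R. p x = v} = c v" by (rule cnt)
  qed
qed

lemma card_forests_delete_leaf:
  assumes "finite V" "R \<subseteq> V" and w: "w \<in> V - R" "c w = 0"
  shows "card (forests V R c) =
    (\<Sum>u | u \<in> V - {w} \<and> 0 < c u. card (forests (V - {w}) R (c(u := c u - 1))))"
proof -
  let ?I = "{u. u \<in> V - {w} \<and> 0 < c u}"
  let ?B = "\<lambda>u. forests (V - {w}) R (c(u := c u - 1))"
  note char = parent_of_leaf[where V = V and R = R and c = c and w = w, OF assms]
  have qw: "q w = w" if "q \<in> ?B u" for q u using that by (auto simp: forests_def)
  have "bij_betw (\<lambda>p. (p w, p(w := w))) (forests V R c) (Sigma ?I ?B)"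
  proof (rule bij_betw_byWitness[where f' = "\<lambda>(u, q). q(w := u)"])
    show "(\<lambda>p. (p w, p(w := w))) ` forests V R c \<subseteq> Sigma ?I ?B"
      using char by auto
    show "(\<lambda>(u, q). q(w := u)) ` Sigma ?I ?B \<subseteq> forests V R c"
      using char qw by (auto simp: fun_upd_idem)
  qed (auto simp: fun_upd_idem qw)
  then have "card (forests V R c) = card (Sigma ?I ?B)" by (rule bij_betw_same_card)
  also have "\<dots> = (\<Sum>u\<in>?I. card (?B u))"
    using assms(1) by (intro card_SigmaI) (auto intro: finite_forests)
  finally show ?thesis .
qed

section \<open>The number of forests with given child counts\<close>

text \<open>The number of forests with \<open>k\<close> vertices besides the roots and \<open>s\<close> children of roots, multiplied
by the factorials of all child counts. The value 1 at \<open>k = 0\<close> accounts for the single forest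
that consists of roots only.\<close>
definition forest_weight :: "nat \<Rightarrow> real \<Rightarrow> real" where
  "forest_weight k s = (if k = 0 then 1 else s * fact (k - 1))"

lemma sum_decrement:
  fixes c :: "'a \<Rightarrow> nat"
  assumes "finite A" "0 < c u"
  shows "(\<Sum>v\<in>A. real ((c(u := c u - 1)) v)) = (\<Sum>v\<in>A. real (c v)) - of_bool (u \<in> A)"
proof (cases "u \<in> A")
  case True
  have "(\<Sum>v\<in>A - {u}. real ((c(u := c u - 1)) v)) = (\<Sum>v\<in>A - {u}. real (c v))"
    by (intro sum.cong) auto
  then show ?thesis using assms True by (simp add: sum.remove[where x = u] of_nat_diff)
next
  case False
  then show ?thesis by (auto intro: sum.cong)
qed

lemma prod_fact_decrement:
  fixes c :: "'a \<Rightarrow> nat"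
  assumes "finite A" "u \<in> A" "0 < c u"
  shows "(\<Prod>v\<in>A. fact (c v) :: real) = c u * (\<Prod>v\<in>A. fact ((c(u := c u - 1)) v))"
proof -
  have "(\<Prod>v\<in>A - {u}. fact ((c(u := c u - 1)) v) :: real) = (\<Prod>v\<in>A - {u}. fact (c v))"
    by (intro prod.cong) auto
  then show ?thesis using assms by (simp add: prod.remove[where x = u] fact_reduce)
qed

lemma exists_child_of_root:
  assumes "reaches p R x" "x \<in> V - R" "\<And>y. y \<in> V - R \<Longrightarrow> p y \<in> V"
  shows "\<exists>w\<in>V - R. p w \<in> R"
  using assms
proof (induction)
  case (climb x)
  then show ?case by (cases "p x \<in> R") auto
qed simp

text \<open>By induction on the number \<open>k + 1\<close> of non-root vertices. If every one of them had a child, all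
children would be used up before any is left for a root; then \<open>s = 0\<close>, and there is no forest
because some vertex has to hang from a root. Otherwise delete a leaf \<open>w\<close>: choosing its parent
\<open>u\<close> contributes \<open>c u * (s - [u \<in> R]) * (k - 1)!\<close>, and as the child counts have sum \<open>k + 1\<close>
overall and \<open>s\<close> on the roots, these add up to \<open>((k + 1) * s - s) * (k - 1)! = s * k!\<close>. This needs
\<open>k > 0\<close>; for \<open>k = 0\<close> the leaf \<open>w\<close> hangs from the only root that has a child.\<close>
lemma card_forests:
  assumes "finite V" "R \<subseteq> V" "(\<Sum>v\<in>V. c v) = card (V - R)"
  shows "real (card (forests V R c)) * (\<Prod>v\<in>V. fact (c v)) =
    forest_weight (card (V - R)) (\<Sum>v\<in>R. real (c v))"
  using assms
proof (induction "card (V - R)" arbitrary: V c)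
  case 0
  then have VR: "V = R" and c0: "\<forall>v\<in>V. c v = 0" by auto
  have "forests V R c = {id}"
    using VR c0 by (auto simp: forests_def)
  then show ?case using VR c0 by (simp add: forest_weight_def)
next
  case (Suc k)
  note fin = \<open>finite V\<close> and RV = \<open>R \<subseteq> V\<close> and cs = \<open>(\<Sum>v\<in>V. c v) = card (V - R)\<close>
  have split: "(\<Sum>v\<in>V. c v) = (\<Sum>v\<in>R. c v) + (\<Sum>v\<in>V - R. c v)"
    using fin RV by (simp add: sum.subset_diff add.commute)
  show ?case
  proof (cases "\<exists>w\<in>V - R. c w = 0")
    case False
    then have "(\<Sum>v\<in>V - R. 1) \<le> (\<Sum>v\<in>V - R. c v)" by (intro sum_mono) (auto simp: Suc_le_eq)
    then have sR: "(\<Sum>v\<in>R. c v) = 0" using split cs by simp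
    have "forests V R c = {}"
    proof (rule ccontr)
      assume "forests V R c \<noteq> {}"
      then obtain p where p: "p \<in> forests V R c" by blast
      obtain x where x: "x \<in> V - R" using \<open>Suc k = card (V - R)\<close>
        by (metis card.empty ex_in_conv nat.distinct(1))
      obtain w where w: "w \<in> V - R" "p w \<in> R"
        using exists_child_of_root[of p R x V] p x by (auto simp: forests_def)
      have "card {y \<in> V - R. p y = p w} = c (p w)" using p w RV by (auto simp: forests_def)
      moreover have "c (p w) = 0" using sR w fin RV by (auto dest: finite_subset)
      ultimately have "{y \<in> V - R. p y = p w} = {}" using fin by auto
      then show False using w by blast
    qed
    then show ?thesis using sR \<open>Suc k = card (V - R)\<close>
      by (simp add: forest_weight_def flip: of_nat_sum)
  next
    case True
    then obtain w where w: "w \<in> V - R" "c w = 0" by blast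
    let ?I = "{u. u \<in> V - {w} \<and> 0 < c u}"
    let ?c = "\<lambda>u. c(u := c u - 1)"
    define C where "C = (\<Sum>v\<in>R. real (c v))"
    have k: "card (V - {w} - R) = k"
    proof -
      have "V - {w} - R = V - R - {w}" by blast
      then show ?thesis using Suc(2) w fin by simp
    qed
    have finR: "finite R" using fin RV finite_subset by blast
    have summand: "real (card (forests (V - {w}) R (?c u))) * (\<Prod>v\<in>V. fact (c v))
       = c u * forest_weight k (C - of_bool (u \<in> R))" if u: "u \<in> ?I" for u
    proof -
      have "(\<Sum>v\<in>V - {w}. c v) = Suc k"
        using w fin cs Suc(2) sum.remove[of V w c] by simp
      then have "(\<Sum>v\<in>V - {w}. real (c v)) = Suc k" by (simp flip: of_nat_sum)
      then have "real (\<Sum>v\<in>V - {w}. ?c u v) = real k"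
        using sum_decrement[of "V - {w}" c u] u fin
        by (simp del: fun_upd_apply)
      then have "(\<Sum>v\<in>V - {w}. ?c u v) = card (V - {w} - R)" using k by linarith
      then have "real (card (forests (V - {w}) R (?c u))) * (\<Prod>v\<in>V - {w}. fact (?c u v))
          = forest_weight k (\<Sum>v\<in>R. real (?c u v))"
        using Suc(1)[of "V - {w}" "?c u"] fin RV w k by auto
      moreover have "(\<Prod>v\<in>V. fact (c v) :: real) = c u * (\<Prod>v\<in>V - {w}. fact (?c u v))"
        using prod_fact_decrement[of "V - {w}" u c] u fin w by (simp add: prod.remove[where x = w] del: fun_upd_apply)
      ultimately show ?thesis using sum_decrement[of R c u] finR u by (simp add: C_def del: fun_upd_apply)
    qed
    have "real (card (forests V R c)) * (\<Prod>v\<in>V. fact (c v))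
        = (\<Sum>u\<in>?I. c u * forest_weight k (C - of_bool (u \<in> R)))"
      using card_forests_delete_leaf[where V = V and R = R and c = c, OF fin RV w] summand
      by (simp add: sum_distrib_right)
    also have "\<dots> = (\<Sum>u\<in>V. c u * forest_weight k (C - of_bool (u \<in> R)))"
      using fin w by (intro sum.mono_neutral_left) auto
    also have "\<dots> = C * fact k"
    proof (cases "k = 0")
      case True
      then have "V - R = {w}" using Suc(2) w
        by (metis card_1_singletonE One_nat_def singletonD)
      then have "(\<Sum>v\<in>V. real (c v)) = C" unfolding C_def using w split by (simp flip: of_nat_sum)
      moreover have "(\<Sum>v\<in>V. real (c v)) = 1" using cs Suc(2) True by (simp flip: of_nat_sum)
      ultimately show ?thesis using True by (simp add: forest_weight_def)
    next
      case False
      have "(\<Sum>u\<in>V. c u * forest_weight k (C - of_bool (u \<in> R)))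
        = (\<Sum>u\<in>V. (real (c u) * C - real (c u) * of_bool (u \<in> R)) * fact (k - 1))"
        using False by (simp add: forest_weight_def algebra_simps)
      also have "\<dots> = ((\<Sum>u\<in>V. real (c u)) * C - (\<Sum>u\<in>V. real (c u) * of_bool (u \<in> R))) * fact (k - 1)"
        by (simp only: sum_distrib_right[symmetric] sum_subtractf)
      also have "(\<Sum>u\<in>V. real (c u) * of_bool (u \<in> R)) = C"
        unfolding C_def using fin RV by (simp add: sum.inter_restrict[symmetric] Int_absorb1 of_bool_def if_distrib cong: if_cong)
      also have "(\<Sum>u\<in>V. real (c u)) = k + 1" using cs Suc(2) by (simp flip: of_nat_sum)
      finally show ?thesis using False by (simp add: fact_reduce[of k] algebra_simps)
    qed
    finally show ?thesis using Suc(2) by (simp add: forest_weight_def C_def flip: Suc(2))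
  qed
qed

section \<open>Forests with a marked vertex at a given depth\<close>

text \<open>Forests in which the marked vertex \<open>z\<close> lies in the tree of the root \<open>r\<close>, at depth \<open>h\<close>.\<close>
definition forests_at :: "'a set \<Rightarrow> 'a set \<Rightarrow> ('a \<Rightarrow> nat) \<Rightarrow> 'a \<Rightarrow> 'a \<Rightarrow> nat \<Rightarrow> ('a \<Rightarrow> 'a) set" where
  "forests_at V R c z r h = {p \<in> forests V R c. (p ^^ h) z = r \<and> (\<forall>i<h. (p ^^ i) z \<notin> R)}"

lemma forests_at_0: "forests_at V R c z r 0 = (if z = r then forests V R c else {})"
  by (auto simp: forests_at_def)

lemma forests_at_root: "z \<in> R \<Longrightarrow> forests_at V R c z r (Suc h) = {}"
  by (auto simp: forests_at_def)

lemma reaches_cut: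
  assumes "p y = r" "r \<in> R" "y \<notin> R"
  shows "reaches p R x \<longleftrightarrow> reaches (p(y := y)) (insert y R) x"
proof
  assume "reaches p R x"
  then show "reaches (p(y := y)) (insert y R) x"
  proof induction
    case (climb x)
    then show ?case by (cases "x = y") (auto simp: fun_upd_def intro: reaches.intros)
  qed (auto intro: reaches.here)
next
  assume "reaches (p(y := y)) (insert y R) x"
  then show "reaches p R x"
  proof induction
    case (here x)
    have "reaches p R y" using assms by (auto intro: reaches.intros)
    then show ?case using here by (auto intro: reaches.here)
  next
    case (climb x)
    then show ?case by (cases "x = y") (auto intro: reaches.intros)
  qed
qed

text \<open>Cutting the edge from a child \<open>y\<close> of the root \<open>r\<close> to \<open>r\<close> turns \<open>y\<close> into a further root and
lowers the child count of \<open>r\<close> by one.\<close>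
lemma forests_cut:
  assumes "finite V" "r \<in> R" "R \<subseteq> V" "y \<in> V - R" "p y = r"
  shows "p \<in> forests V R c \<longleftrightarrow> 0 < c r \<and> p(y := y) \<in> forests V (insert y R) (c(r := c r - 1))"
proof -
  let ?q = "p(y := y)"
  have fin: "finite {w \<in> V - R. p w = v}" for v using assms by auto
  have sets: "{w \<in> V - insert y R. ?q w = v} = {w \<in> V - R. p w = v} - {y}" for v by auto
  have cards: "card {w \<in> V - R. p w = v} = (if v = r then Suc (card {w \<in> V - insert y R. ?q w = v}) 
     else card {w \<in> V - insert y R. ?q w = v})" for v
    unfolding sets using fin[of v] assms card_Suc_Diff1[OF fin[of v], of y]
    by (auto simp: card_Diff_singleton_if)
  have reach: "reaches p R x \<longleftrightarrow> reaches ?q (insert y R) x" for x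
    using reaches_cut[of p y r R x] assms by auto
  have "(\<forall>x. x \<notin> V - R \<longrightarrow> p x = x) \<longleftrightarrow> (\<forall>x. x \<notin> V - insert y R \<longrightarrow> ?q x = x)"
    using assms by auto
  moreover have "(\<forall>x\<in>V - R. p x \<in> V \<and> reaches p R x) \<longleftrightarrow>
     (\<forall>x\<in>V - insert y R. ?q x \<in> V \<and> reaches ?q (insert y R) x)"
  proof -
    have "reaches p R y" using assms by (auto intro: reaches.intros)
    then show ?thesis using assms reach by auto
  qed
  moreover have "(\<forall>v\<in>V. card {w \<in> V - R. p w = v} = c v) \<longleftrightarrow>
     0 < c r \<and> (\<forall>v\<in>V. card {w \<in> V - insert y R. ?q w = v} = (c(r := c r - 1)) v)"
    using assms(2,3) unfolding cards by (auto split: if_splits)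
  ultimately show ?thesis unfolding forests_def mem_Collect_eq by blast
qed

lemma funpow_agree:
  fixes p :: "'a \<Rightarrow> 'a"
  assumes "\<And>i. i < h \<Longrightarrow> (p ^^ i) z \<noteq> y" "i \<le> h"
  shows "((p(y := u)) ^^ i) z = (p ^^ i) z"
  using assms(2)
proof (induction i)
  case (Suc i)
  then show ?case using assms(1)[of i] by simp
qed simp

text \<open>Applied to the child \<open>y\<close> of \<open>r\<close> through which the path from \<open>z\<close> runs, cutting brings \<open>z\<close> one
step closer to its root. Iterated, it detaches the path vertex by vertex, starting at \<open>r\<close>.\<close>
lemma forests_at_cut:
  assumes "finite V" "r \<in> R" "R \<subseteq> V" "z \<in> V"
  shows "p \<in> forests_at V R c z r (Suc h) \<longleftrightarrow>
     (\<exists>y\<in>V - R. p y = r \<and> (p ^^ h) z = y \<and> 0 < c r \<and>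
        p(y := y) \<in> forests_at V (insert y R) (c(r := c r - 1)) z y h)"
proof
  assume p: "p \<in> forests_at V R c z r (Suc h)"
  define y where "y = (p ^^ h) z"
  have pf: "p \<in> forests V R c" and py: "p y = r" and nR: "\<And>i. i \<le> h \<Longrightarrow> (p ^^ i) z \<notin> R"
    using p by (auto simp: forests_at_def y_def less_Suc_eq_le)
  have "(p ^^ i) z \<in> V" if "i \<le> h" for i
    using that
  proof (induction i)
    case (Suc i)
    then show ?case using nR[of i] pf by (auto simp: forests_def)
  qed (use assms in simp)
  then have y: "y \<in> V - R" using nR by (auto simp: y_def)
  have ny: "(p ^^ i) z \<noteq> y" if "i < h" for i
  proof
    assume "(p ^^ i) z = y"
    then have "(p ^^ Suc i) z \<in> R" using py assms by simp
    then show False using nR[of "Suc i"] that by simp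
  qed
  note agree = funpow_agree[where p = p and h = h and z = z and y = y and u = y, OF ny]
  have "p(y := y) \<in> forests_at V (insert y R) (c(r := c r - 1)) z y h"
    unfolding forests_at_def mem_Collect_eq
    using forests_cut[of V r R y p c, OF assms(1-3) y py] pf agree nR ny by (auto simp: y_def)
  then show "\<exists>y\<in>V - R. p y = r \<and> (p ^^ h) z = y \<and> 0 < c r \<and>
        p(y := y) \<in> forests_at V (insert y R) (c(r := c r - 1)) z y h"
    using forests_cut[of V r R y p c, OF assms(1-3) y py] pf y py by (auto simp: y_def)
next
  assume "\<exists>y\<in>V - R. p y = r \<and> (p ^^ h) z = y \<and> 0 < c r \<and>
        p(y := y) \<in> forests_at V (insert y R) (c(r := c r - 1)) z y h"
  then obtain y where y: "y \<in> V - R" "p y = r" "(p ^^ h) z = y" "0 < c r"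
    and q: "p(y := y) \<in> forests_at V (insert y R) (c(r := c r - 1)) z y h" by blast
  have ny: "((p(y := y)) ^^ i) z \<noteq> y" if "i < h" for i using q that by (auto simp: forests_at_def)
  have agree: "(p ^^ i) z = ((p(y := y)) ^^ i) z" if "i \<le> h" for i
    using funpow_agree[where p = "p(y := y)" and h = h and z = z and y = y and u = "p y", OF ny that] by simp
  have "(p ^^ i) z \<notin> R" if "i < Suc h" for i
    using that q y agree by (cases "i = h") (auto simp: forests_at_def)
  then show "p \<in> forests_at V R c z r (Suc h)"
    using forests_cut[of V r R y p c, OF assms(1-3) y(1,2)] q y by (auto simp: forests_at_def)
qed

lemma finite_forests_at: "finite V \<Longrightarrow> finite (forests_at V R c z r h)"
  by (simp add: forests_at_def finite_forests)

lemma card_forests_at_Suc: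
  assumes "finite V" "r \<in> R" "R \<subseteq> V" "z \<in> V"
  shows "card (forests_at V R c z r (Suc h)) =
    (if c r = 0 then 0 else \<Sum>y\<in>V - R. card (forests_at V (insert y R) (c(r := c r - 1)) z y h))"
proof -
  let ?X = "forests_at V R c z r (Suc h)"
  let ?B = "\<lambda>y. forests_at V (insert y R) (c(r := c r - 1)) z y h"
  note cut = forests_at_cut[OF assms, of _ c h]
  show ?thesis
  proof (cases "c r = 0")
    case True
    then have "?X = {}" by (simp add: set_eq_iff cut)
    then show ?thesis using True by simp
  next
    case False
    have restore: "((q(y := r)) ^^ h) z = y \<and> q y = y" if "q \<in> ?B y" for q y
    proof -
      have ne: "(q ^^ i) z \<noteq> y" if "i < h" for i
        using \<open>q \<in> ?B y\<close> that by (auto simp: forests_at_def)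
      have "((q(y := r)) ^^ h) z = (q ^^ h) z"
        by (rule funpow_agree[where p = q and h = h and z = z and y = y, OF ne order_refl])
      then show ?thesis using that by (auto simp: forests_at_def forests_def)
    qed
    have "bij_betw (\<lambda>p. ((p ^^ h) z, p((p ^^ h) z := (p ^^ h) z))) ?X (Sigma (V - R) ?B)"
    proof (rule bij_betw_byWitness[where f' = "\<lambda>(y, q). q(y := r)"])
      show "\<forall>p\<in>?X. (\<lambda>(y, q). q(y := r)) ((p ^^ h) z, p((p ^^ h) z := (p ^^ h) z)) = p"
        using cut by (auto simp: fun_upd_idem)
      show "\<forall>a\<in>Sigma (V - R) ?B. (\<lambda>p. ((p ^^ h) z, p((p ^^ h) z := (p ^^ h) z))) ((\<lambda>(y, q). q(y := r)) a) = a"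
        using restore by (auto simp: fun_upd_idem)
      show "(\<lambda>p. ((p ^^ h) z, p((p ^^ h) z := (p ^^ h) z))) ` ?X \<subseteq> Sigma (V - R) ?B"
        using cut by auto
      show "(\<lambda>(y, q). q(y := r)) ` Sigma (V - R) ?B \<subseteq> ?X"
      proof (rule image_subsetI)
        fix a assume a: "a \<in> Sigma (V - R) ?B"
        obtain y q where aq: "a = (y, q)" by fastforce
        have y: "y \<in> V - R" and q: "q \<in> ?B y" using a aq by auto
        have "(q(y := r))(y := y) = q" using restore[OF q] by (auto simp: fun_upd_idem)
        then have "\<exists>u\<in>V - R. (q(y := r)) u = r \<and> ((q(y := r)) ^^ h) z = u \<and> 0 < c r \<and>
          (q(y := r))(u := u) \<in> ?B u" using y q restore[OF q] False by (intro bexI[of _ y]) auto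
        then have "q(y := r) \<in> ?X" unfolding cut .
        then show "(\<lambda>(y, q). q(y := r)) a \<in> ?X" using aq by simp
      qed
    qed
    then have "card ?X = card (Sigma (V - R) ?B)" by (rule bij_betw_same_card)
    also have "\<dots> = (\<Sum>y\<in>V - R. card (?B y))"
      using assms(1) by (intro card_SigmaI) (auto intro: finite_forests_at)
    finally show ?thesis using False by simp
  qed
qed

definition subsets_of_card :: "nat \<Rightarrow> 'a set \<Rightarrow> 'a set set" where
  "subsets_of_card k X = {A. A \<subseteq> X \<and> card A = k}"

lemma finite_subsets_of_card: "finite X \<Longrightarrow> finite (subsets_of_card k X)"
  by (simp add: subsets_of_card_def)

lemma subsets_of_card_0: "finite X \<Longrightarrow> subsets_of_card 0 X = {{}}"
  by (auto simp: subsets_of_card_def dest: finite_subset)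

text \<open>The pairs of a set of size \<open>k + 1\<close> and one of its elements, enumerated by the element first or by
the set first.\<close>
lemma sum_pointed_subsets:
  fixes g :: "'a \<Rightarrow> 'a set \<Rightarrow> 'b::comm_monoid_add"
  assumes "finite X"
  shows "(\<Sum>y\<in>X. \<Sum>A\<in>subsets_of_card k (X - {y}). g y A) =
    (\<Sum>A\<in>subsets_of_card (Suc k) X. \<Sum>y\<in>A. g y (A - {y}))"
proof -
  have fin: "finite A" if "A \<subseteq> X" for A using assms that finite_subset by blast
  have "(\<Sum>y\<in>X. \<Sum>A\<in>subsets_of_card k (X - {y}). g y A)
     = (\<Sum>(y, A)\<in>Sigma X (\<lambda>y. subsets_of_card k (X - {y})). g y A)"
    using assms by (intro sum.Sigma) (auto intro: finite_subsets_of_card)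
  also have "\<dots> = (\<Sum>(A, y)\<in>Sigma (subsets_of_card (Suc k) X) (\<lambda>A. A). g y (A - {y}))"
  proof (rule sum.reindex_bij_witness[where i = "\<lambda>(A, y). (y, A - {y})" and j = "\<lambda>(y, A). (insert y A, y)"])
    fix a assume a: "a \<in> Sigma X (\<lambda>y. subsets_of_card k (X - {y}))"
    obtain y A where [simp]: "a = (y, A)" by fastforce
    have A: "y \<in> X" "A \<subseteq> X - {y}" "card A = k" "finite A" using a fin by (auto simp: subsets_of_card_def)
    then have [simp]: "insert y A - {y} = A" by auto
    show "(\<lambda>(A, y). (y, A - {y})) ((\<lambda>(y, A). (insert y A, y)) a) = a" by simp
    have "y \<notin> A" using A by auto
    then show "(\<lambda>(y, A). (insert y A, y)) a \<in> Sigma (subsets_of_card (Suc k) X) (\<lambda>A. A)"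
      using A by (auto simp: subsets_of_card_def)
    show "(case (\<lambda>(y, A). (insert y A, y)) a of (A, y) \<Rightarrow> g y (A - {y})) = (case a of (y, A) \<Rightarrow> g y A)" by simp
  next
    fix b assume b: "b \<in> Sigma (subsets_of_card (Suc k) X) (\<lambda>A. A)"
    obtain A y where [simp]: "b = (A, y)" by fastforce
    have A: "y \<in> A" "A \<subseteq> X" "card A = Suc k" "finite A" using b fin by (auto simp: subsets_of_card_def)
    show "(\<lambda>(y, A). (insert y A, y)) ((\<lambda>(A, y). (y, A - {y})) b) = b" using A by auto
    show "(\<lambda>(A, y). (y, A - {y})) b \<in> Sigma X (\<lambda>y. subsets_of_card k (X - {y}))"
      using A by (auto simp: subsets_of_card_def)
  qed
  also have "\<dots> = (\<Sum>A\<in>subsets_of_card (Suc k) X. \<Sum>y\<in>A. g y (A - {y}))"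
    using assms fin by (intro sum.Sigma[symmetric]) (auto intro: finite_subsets_of_card simp: subsets_of_card_def)
  finally show ?thesis .
qed

corollary sum_insert_subsets:
  fixes f :: "'a set \<Rightarrow> real"
  assumes "finite X"
  shows "(\<Sum>y\<in>X. \<Sum>A\<in>subsets_of_card k (X - {y}). f (insert y A)) =
    Suc k * (\<Sum>A\<in>subsets_of_card (Suc k) X. f A)"
proof -
  have "(\<Sum>A\<in>subsets_of_card (Suc k) X. \<Sum>y\<in>A. f (insert y (A - {y}))) =
    (\<Sum>A\<in>subsets_of_card (Suc k) X. Suc k * f A)"
    by (intro sum.cong) (auto simp: subsets_of_card_def insert_absorb)
  then show ?thesis
    by (simp only: sum_pointed_subsets[OF assms] sum_distrib_left)
qed

text \<open>Once the edges of the path from \<open>r\<close> down to \<open>z\<close> are cut, the path has become part of the root set,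
and the forests are counted by \<open>card_forests\<close>. Here \<open>A\<close> is the set of inner vertices of the
path; they occur in any of \<open>h!\<close> orders, and each of them gives up one of its \<open>c v\<close> children to
the path, whence the product and the summands \<open>c v - 1\<close>.\<close>
lemma card_forests_at:
  assumes "finite V" "r \<in> R" "R \<subseteq> V" "z \<in> V - R" "(\<Sum>v\<in>V. c v) = card (V - R)"
  shows "real (card (forests_at V R c z r (Suc h))) * (\<Prod>v\<in>V. fact (c v)) =
    fact h * c r * (\<Sum>A\<in>subsets_of_card h (V - R - {z}). (\<Prod>v\<in>A. real (c v)) *
       forest_weight (card (V - R) - Suc h) ((\<Sum>v\<in>R. real (c v)) - 1 + (\<Sum>v\<in>A. real (c v) - 1) + c z))"
  using assms
proof (induction h arbitrary: R c r)
  case (0 R c r)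
  have finR: "finite R" using 0 finite_subset by blast
  have [simp]: "subsets_of_card 0 (V - R - {z}) = {{}}"
    using 0(1) by (simp add: subsets_of_card_0)
  show ?case
  proof (cases "c r = 0")
    case True then show ?thesis using card_forests_at_Suc[of V r R z c 0] 0 by simp
  next
    case False
    let ?c = "c(r := c r - 1)"
    have cd: "card (V - insert z R) = card (V - R) - 1"
      using 0 by (metis Diff_insert card_Diff_singleton)
    have rV: "r \<in> V" using 0 by auto
    have "card (V - R) > 0" using 0 by (auto simp: card_gt_0_iff)
    then have "real (\<Sum>v\<in>V. ?c v) = real (card (V - insert z R))"
      using sum_decrement[of V c r] 0 False rV cd by (simp add: of_nat_diff del: fun_upd_apply flip: of_nat_sum)
    then have s: "(\<Sum>v\<in>V. ?c v) = card (V - insert z R)" by linarith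
    have "(\<Sum>y\<in>V - R. card (forests_at V (insert y R) ?c z y 0)) = (\<Sum>y\<in>V - R. if z = y then card (forests V (insert z R) ?c) else 0)"
      by (intro sum.cong) (auto simp: forests_at_0)
    also have "\<dots> = card (forests V (insert z R) ?c)" using 0 by simp
    finally have X: "card (forests_at V R c z r (Suc 0)) = card (forests V (insert z R) ?c)"
      using card_forests_at_Suc[of V r R z c 0] 0 False by simp
    have "(\<Sum>v\<in>insert z R. real (?c v)) = (\<Sum>v\<in>R. real (c v)) - 1 + c z"
      using sum_decrement[of "insert z R" c r] False 0 finR by (simp del: fun_upd_apply)
    then have "real (card (forests V (insert z R) ?c)) * (\<Prod>v\<in>V. fact (?c v)) =
      forest_weight (card (V - R) - 1) ((\<Sum>v\<in>R. real (c v)) - 1 + c z)"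
      using card_forests[of V "insert z R" ?c] 0 s cd by (simp del: fun_upd_apply)
    then show ?thesis using prod_fact_decrement[of V r c] X rV 0 False by (simp del: fun_upd_apply)
  qed
next
  case (Suc h R c r)
  have finR: "finite R" using Suc finite_subset by blast
  let ?X = "V - R - {z}"
  let ?C = "\<Sum>v\<in>R. real (c v)"
  have finX: "finite ?X" using Suc by auto
  show ?case
  proof (cases "c r = 0")
    case True then show ?thesis using card_forests_at_Suc[of V r R z c "Suc h"] Suc by simp
  next
    case False
    let ?c = "c(r := c r - 1)"
    have rV: "r \<in> V" using Suc by auto
    have pos: "card (V - R) > 0" using Suc.prems by (auto simp: card_gt_0_iff)
    define f where "f A = (\<Prod>v\<in>A. real (c v)) * forest_weight (card (V - R) - Suc (Suc h)) (?C - 1 + (\<Sum>v\<in>A. real (c v) - 1) + c z)" for A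
    \<comment> \<open>The vertex below \<open>r\<close> on the path is \<open>y\<close>, and the induction hypothesis describes the rest.\<close>
    have y: "real (card (forests_at V (insert y R) ?c z y (Suc h))) * (\<Prod>v\<in>V. fact (?c v)) =
        fact h * (\<Sum>A\<in>subsets_of_card h (?X - {y}). f (insert y A))" if y: "y \<in> ?X" for y
    proof -
      have cd: "card (V - insert y R) = card (V - R) - 1"
        using Suc.prems y by (metis Diff_insert card_Diff_singleton DiffD1)
      have "real (\<Sum>v\<in>V. ?c v) = real (card (V - insert y R))"
        using sum_decrement[of V c r] Suc.prems False rV cd pos
        by (simp add: of_nat_diff del: fun_upd_apply flip: of_nat_sum)
      then have s: "(\<Sum>v\<in>V. ?c v) = card (V - insert y R)" by linarith
      have C: "(\<Sum>v\<in>insert y R. real (?c v)) = ?C - 1 + c y"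
        using sum_decrement[of "insert y R" c r] False Suc.prems finR y by (simp del: fun_upd_apply)
      have same: "?c v = c v" if "v \<in> V - R" for v using Suc.prems that by auto
      have X: "V - insert y R - {z} = ?X - {y}" by auto
      have "real (card (forests_at V (insert y R) ?c z y (Suc h))) * (\<Prod>v\<in>V. fact (?c v)) =
         fact h * real (?c y) * (\<Sum>A\<in>subsets_of_card h (?X - {y}). (\<Prod>v\<in>A. real (?c v)) *
          forest_weight (card (V - R) - 1 - Suc h) (?C - 1 + c y - 1 + (\<Sum>v\<in>A. real (?c v) - 1) + ?c z))"
      proof -
        have "y \<in> insert y R" "insert y R \<subseteq> V" "z \<in> V - insert y R" using Suc.prems y by auto
        from Suc.IH[where r = y and R = "insert y R" and c = ?c, OF Suc.prems(1) this s]
        show ?thesis unfolding C cd X .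
      qed
      also have "\<dots> = fact h * (\<Sum>A\<in>subsets_of_card h (?X - {y}). f (insert y A))"
      proof -
        have "real (?c y) * ((\<Prod>v\<in>A. real (?c v)) *
          forest_weight (card (V - R) - 1 - Suc h) (?C - 1 + c y - 1 + (\<Sum>v\<in>A. real (?c v) - 1) + ?c z))
          = f (insert y A)" if A: "A \<in> subsets_of_card h (?X - {y})" for A
        proof -
          have fA: "finite A" "y \<notin> A" "A \<subseteq> V - R" using A finX by (auto simp: subsets_of_card_def dest: finite_subset)
          have "(\<Prod>v\<in>A. real (?c v)) = (\<Prod>v\<in>A. real (c v))" "(\<Sum>v\<in>A. real (?c v) - 1) = (\<Sum>v\<in>A. real (c v) - 1)"
            using fA same by (auto intro!: prod.cong sum.cong simp del: fun_upd_apply)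
          then show ?thesis using fA same[of y] same[of z] y Suc.prems
            by (simp add: f_def algebra_simps del: fun_upd_apply)
        qed
        then show ?thesis by (simp add: sum_distrib_left mult.assoc del: fun_upd_apply)
      qed
      finally show ?thesis .
    qed
    have "card (forests_at V R c z r (Suc (Suc h))) = (\<Sum>y\<in>V - R. card (forests_at V (insert y R) ?c z y (Suc h)))"
      using card_forests_at_Suc[of V r R z c "Suc h"] Suc.prems False by simp
    also have "\<dots> = (\<Sum>y\<in>?X. card (forests_at V (insert y R) ?c z y (Suc h)))"
      using Suc.prems(1,4) by (simp add: sum.remove[where x = z] forests_at_root del: fun_upd_apply)
    finally have "real (card (forests_at V R c z r (Suc (Suc h)))) * (\<Prod>v\<in>V. fact (?c v)) =
      (\<Sum>y\<in>?X. fact h * (\<Sum>A\<in>subsets_of_card h (?X - {y}). f (insert y A)))"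
      using y by (simp add: sum_distrib_right del: fun_upd_apply)
    also have "\<dots> = fact (Suc h) * (\<Sum>A\<in>subsets_of_card (Suc h) ?X. f A)"
      by (simp only: sum_distrib_left[symmetric] sum_insert_subsets[OF finX] fact_Suc mult_ac)
    finally show ?thesis
      using prod_fact_decrement[of V r c] rV Suc.prems False
      by (simp add: f_def mult.assoc del: fun_upd_apply fact_Suc)
  qed
qed

section \<open>Rooted trees as parent maps\<close>

definition graph_of :: "'a set \<Rightarrow> 'a \<Rightarrow> ('a \<Rightarrow> 'a) \<Rightarrow> 'a rooted_graph" where
  "graph_of V r p = \<lparr>tedges = (\<Union>x\<in>V - {r}. {(x, p x), (p x, x)}), troot = r\<rparr>"

definition depth :: "('a \<Rightarrow> 'a) \<Rightarrow> 'a \<Rightarrow> 'a \<Rightarrow> nat" where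
  "depth p r x = (LEAST k. (p ^^ k) x = r)"

lemma reaches_funpow:
  assumes "reaches p R x"
  shows "\<exists>k. (p ^^ k) x \<in> R"
  using assms
proof induction
  case (here x) then show ?case by (intro exI[of _ 0]) simp
next
  case (climb x)
  then obtain k where "(p ^^ k) (p x) \<in> R" by blast
  then show ?case by (intro exI[of _ "Suc k"]) (simp add: funpow_swap1)
qed

lemma depth_root: "depth p r r = 0"
  unfolding depth_def by (rule Least_equality) auto

lemma depth_parent:
  assumes "reaches p {r} x" "x \<noteq> r"
  shows "depth p r x = Suc (depth p r (p x))"
proof -
  obtain k where "(p ^^ k) x = r" using reaches_funpow[OF assms(1)] by blast
  then have "(LEAST k. (p ^^ k) x = r) = Suc (LEAST m. (p ^^ Suc m) x = r)"
    using assms(2) by (intro Least_Suc[of _ k]) auto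
  then show ?thesis unfolding depth_def by (simp add: funpow_swap1)
qed

text \<open>The graph of a parent map with the single root \<open>r\<close> is a tree: the distance to \<open>r\<close> is the number of
applications of \<open>p\<close> needed to reach \<open>r\<close>, because this number changes by exactly one along an edge.\<close>
locale parent_map =
  fixes V :: "'a set" and r :: 'a and c :: "'a \<Rightarrow> nat" and p :: "'a \<Rightarrow> 'a"
  assumes finV: "finite V" and rV: "r \<in> V" and p: "p \<in> forests V {r} c"
begin

abbreviation "T \<equiv> graph_of V r p"
abbreviation "E \<equiv> tedges T"

lemma parent_in: "x \<in> V - {r} \<Longrightarrow> p x \<in> V"
  and reach: "x \<in> V - {r} \<Longrightarrow> reaches p {r} x"
  and childcount: "v \<in> V \<Longrightarrow> card {w \<in> V - {r}. p w = v} = c v"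
  using p by (auto simp: forests_def)

lemma depth_Suc: "x \<in> V - {r} \<Longrightarrow> depth p r x = Suc (depth p r (p x))"
  using depth_parent[OF reach] by auto

lemma depth_0: "x \<in> V \<Longrightarrow> depth p r x = 0 \<longleftrightarrow> x = r"
  using depth_Suc[of x] by (cases "x = r") (auto simp: depth_root)

lemma edge_iff: "(x, y) \<in> E \<longleftrightarrow> x \<in> V - {r} \<and> y = p x \<or> y \<in> V - {r} \<and> x = p y"
  by (auto simp: graph_of_def)

lemma edge_in: "(x, y) \<in> E \<Longrightarrow> x \<in> V \<and> y \<in> V"
  using parent_in by (auto simp: edge_iff)

lemma simple: "simple_graph_on V E"
  unfolding simple_graph_on_def
proof (intro conjI)
  show "E \<subseteq> V \<times> V" using edge_in by auto
  show "sym E" by (rule symI) (auto simp: edge_iff)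
  show "irrefl E"
  proof (rule irreflI)
    fix x show "(x, x) \<notin> E" using depth_Suc[of x] by (auto simp: edge_iff)
  qed
qed

lemma walk_to_root: "x \<in> V \<Longrightarrow> (r, x) \<in> E ^^ depth p r x"
proof (induction "depth p r x" arbitrary: x)
  case 0
  then show ?case using depth_0[of x] by (simp add: depth_root)
next
  case (Suc k)
  then have x: "x \<in> V - {r}" using depth_root[of p r] by auto
  then have "(r, p x) \<in> E ^^ k" using Suc depth_Suc[OF x] parent_in by auto
  moreover have "(p x, x) \<in> E" using x by (auto simp: edge_iff)
  ultimately have "(r, x) \<in> E ^^ Suc k" by auto
  then show ?case using Suc(2) by simp
qed

lemma depth_le_walk: "(r, x) \<in> E ^^ k \<Longrightarrow> depth p r x \<le> k"
proof (induction k arbitrary: x)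
  case 0 then show ?case by (auto simp: depth_root)
next
  case (Suc k)
  then obtain y where y: "(r, y) \<in> E ^^ k" "(y, x) \<in> E" by auto
  then show ?case using Suc.IH[OF y(1)] depth_Suc[of x] depth_Suc[of y] by (auto simp: edge_iff)
qed

lemma ht_eq_depth: "x \<in> V \<Longrightarrow> ht T x = depth p r x"
proof -
  assume "x \<in> V"
  moreover have "troot T = r" by (simp add: graph_of_def)
  ultimately show ?thesis unfolding ht_def graph_dist_def
    using walk_to_root depth_le_walk by (auto intro!: Least_equality)
qed

lemma no_cycle: "\<not> is_cycle E xs"
proof
  assume cyc: "is_cycle E xs"
  define l where "l = length xs"
  have l: "3 \<le> l" and dist: "distinct xs"
    and e: "\<And>i. i < l \<Longrightarrow> (xs ! i, xs ! (Suc i mod l)) \<in> E"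
    using cyc by (auto simp: is_cycle_def l_def)
  let ?D = "(\<lambda>i. depth p r (xs ! i)) ` {..<l}"
  have "finite ?D" "?D \<noteq> {}"
    using l by (auto simp: lessThan_empty_iff)
  then have "Max ?D \<in> ?D" and ge: "\<And>d. d \<in> ?D \<Longrightarrow> d \<le> Max ?D" by auto
  then obtain i where i: "i < l" and M: "Max ?D = depth p r (xs ! i)" by blast
  have imax: "depth p r (xs ! j) \<le> depth p r (xs ! i)" if "j < l" for j
    using ge[of "depth p r (xs ! j)"] that unfolding M by blast
  \<comment> \<open>Both cyclic neighbours of the deepest vertex have to be its parent.\<close>
  have par: "y = p (xs ! i)" if "(xs ! i, y) \<in> E" "depth p r y \<le> depth p r (xs ! i)" for y
    using that depth_Suc[of y] by (auto simp: edge_iff)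
  define j where "j = (if i = 0 then l - 1 else i - 1)"
  have j: "j < l" "Suc j mod l = i" using i l by (auto simp: j_def)
  define k where "k = Suc i mod l"
  have k: "k < l" using l by (auto simp: k_def)
  have "j \<noteq> k"
  proof (cases "Suc i < l")
    case True then show ?thesis using l by (auto simp: j_def k_def)
  next
    case False
    then have "Suc i = l" using i by simp
    then show ?thesis using l by (auto simp: j_def k_def)
  qed
  moreover have "xs ! k = p (xs ! i)" using par[OF _ imax[OF k]] e[OF i] by (simp add: k_def)
  moreover have "xs ! j = p (xs ! i)" 
  proof (rule par[OF _ imax[OF j(1)]])
    have "(xs ! j, xs ! i) \<in> E" using e[OF j(1)] j by simp
    then show "(xs ! i, xs ! j) \<in> E" using simple by (auto simp: simple_graph_on_def dest: symD)
  qed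
  ultimately show False using nth_eq_iff_index_eq[OF dist, of j k] j(1) k by (simp add: l_def)
qed

lemma connected: "u \<in> V \<Longrightarrow> v \<in> V \<Longrightarrow> (u, v) \<in> E\<^sup>*"
proof -
  assume "u \<in> V" "v \<in> V"
  then have "(r, u) \<in> E\<^sup>*" "(r, v) \<in> E\<^sup>*" using walk_to_root relpow_imp_rtrancl by metis+
  moreover have "sym (E\<^sup>*)" using simple by (auto simp: simple_graph_on_def intro: sym_rtrancl)
  ultimately show ?thesis by (meson rtrancl_trans symD)
qed

lemma children_eq: "v \<in> V \<Longrightarrow> children T v = {w \<in> V - {r}. p w = v}"
proof -
  assume v: "v \<in> V"
  show ?thesis
  proof (intro set_eqI iffI)
    fix w assume "w \<in> children T v"
    then have "(v, w) \<in> E" "depth p r w = Suc (depth p r v)"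
      using v edge_in by (auto simp: children_def ht_eq_depth)
    then show "w \<in> {w \<in> V - {r}. p w = v}" using depth_Suc[of v] by (auto simp: edge_iff)
  next
    fix w assume "w \<in> {w \<in> V - {r}. p w = v}"
    then show "w \<in> children T v"
      using v depth_Suc[of w] by (auto simp: children_def ht_eq_depth edge_iff)
  qed
qed

lemma in_trees_of: "T \<in> trees_of V c"
proof -
  have "tree_on V E" unfolding tree_on_def using simple connected no_cycle by blast
  then show ?thesis using rV children_eq childcount
    by (auto simp: trees_of_def rooted_tree_on_def graph_of_def)
qed

lemma parent_unique:
  assumes "x \<in> V - {r}" "(x, y) \<in> E" "ht T y < ht T x"
  shows "y = p x"
  using assms edge_in[OF assms(2)] depth_Suc[of y] by (auto simp: edge_iff ht_eq_depth)

end

text \<open>The parent of a vertex is its only neighbour that is closer to the root, so the graph determines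
the parent map.\<close>
lemma inj_on_graph_of:
  assumes "finite V" "r \<in> V"
  shows "inj_on (graph_of V r) (forests V {r} c)"
proof (rule inj_onI)
  fix p q assume pq: "p \<in> forests V {r} c" "q \<in> forests V {r} c" and eq: "graph_of V r p = graph_of V r q"
  interpret P: parent_map V r c p using assms pq by unfold_locales
  interpret Q: parent_map V r c q using assms pq by unfold_locales
  show "p = q"
  proof
    fix x show "p x = q x"
    proof (cases "x \<in> V - {r}")
      case True
      have "(x, p x) \<in> P.E" using True by (auto simp: P.edge_iff)
      moreover have "ht (graph_of V r p) (p x) < ht (graph_of V r p) x"
        using True P.parent_in[OF True] P.depth_Suc[OF True] by (simp add: P.ht_eq_depth)
      ultimately show ?thesis using Q.parent_unique[OF True] eq by simp
    next
      case False
      then show ?thesis using pq by (auto simp: forests_def)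
    qed
  qed
qed

lemma distinct_walk:
  assumes "(u, v) \<in> E\<^sup>*"
  shows "\<exists>xs. xs \<noteq> [] \<and> hd xs = u \<and> last xs = v \<and> distinct xs \<and> successively (\<lambda>x y. (x, y) \<in> E) xs"
  using assms
proof (induction)
  case base
  then show ?case by (intro exI[of _ "[u]"]) auto
next
  case (step y z)
  then obtain xs where xs: "xs \<noteq> []" "hd xs = u" "last xs = y" "distinct xs"
    "successively (\<lambda>x y. (x, y) \<in> E) xs" by blast
  show ?case
  proof (cases "z \<in> set xs")
    case False
    then show ?thesis using xs step by (intro exI[of _ "xs @ [z]"]) (auto simp: successively_append_iff)
  next
    case True
    then obtain as bs where "xs = as @ z # bs" by (meson split_list)
    then show ?thesis using xs by (intro exI[of _ "as @ [z]"]) (auto simp: successively_append_iff hd_append split: if_splits)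
  qed
qed

lemma cycle_of_extra_edge:
  assumes "(u, v) \<in> F\<^sup>*" "F \<subseteq> E" "(u, v) \<notin> F" "u \<noteq> v" "(v, u) \<in> E"
  shows "\<exists>xs. is_cycle E xs"
proof -
  obtain xs where xs: "xs \<noteq> []" "hd xs = u" "last xs = v" "distinct xs"
    "successively (\<lambda>x y. (x, y) \<in> F) xs" using distinct_walk[OF assms(1)] by blast
  have len: "3 \<le> length xs"
  proof (rule ccontr)
    assume "\<not> 3 \<le> length xs"
    then consider x where "xs = [x]" | x y where "xs = [x, y]"
      using xs(1) by (cases xs; cases "tl xs"; cases "tl (tl xs)") auto
    then show False using xs assms by cases auto
  qed
  have "(xs ! i, xs ! (Suc i mod length xs)) \<in> E" if i: "i < length xs" for i
  proof (cases "Suc i < length xs")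
    case True
    then show ?thesis using xs(5) assms(2) by (auto simp: successively_conv_nth)
  next
    case False
    then have "i = length xs - 1" "Suc i = length xs" using i by auto
    then have "xs ! i = v" "xs ! (Suc i mod length xs) = u" using xs by (auto simp: last_conv_nth hd_conv_nth)
    then show ?thesis using assms by simp
  qed
  then show ?thesis using len xs by (auto simp: is_cycle_def)
qed

text \<open>Choose for every vertex a neighbour that is closer to the root. The chosen edges already connect
all vertices, so any further edge would close a cycle.\<close>
lemma graph_of_surj:
  assumes "finite V" and T: "T \<in> trees_of V c"
  shows "\<exists>p\<in>forests V {troot T} c. T = graph_of V (troot T) p"
proof -
  let ?r = "troot T" and ?E = "tedges T"
  have tree: "tree_on V ?E" and r: "?r \<in> V" and cnt: "\<And>v. v \<in> V \<Longrightarrow> card (children T v) = c v"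
    using T by (auto simp: trees_of_def rooted_tree_on_def)
  have EV: "?E \<subseteq> V \<times> V" and sym: "sym ?E" and irr: "irrefl ?E" and con: "\<And>u v. u \<in> V \<Longrightarrow> v \<in> V \<Longrightarrow> (u, v) \<in> ?E\<^sup>*"
    and acyc: "\<And>xs. \<not> is_cycle ?E xs"
    using tree by (auto simp: tree_on_def simple_graph_on_def)
  have walk: "(?r, x) \<in> ?E ^^ ht T x" if "x \<in> V" for x
    unfolding ht_def graph_dist_def
    using rtrancl_imp_relpow[OF con[OF r that]] by (metis LeastI)
  have ht_le: "ht T x \<le> k" if "(?r, x) \<in> ?E ^^ k" for x k
    unfolding ht_def graph_dist_def using that by (rule Least_le)
  have ex: "\<exists>y. (x, y) \<in> ?E \<and> ht T x = Suc (ht T y)" if x: "x \<in> V - {?r}" for x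
  proof -
    have "ht T x \<noteq> 0"
    proof
      assume "ht T x = 0"
      then show False using walk[of x] x by auto
    qed
    then obtain k where k: "ht T x = Suc k" by (cases "ht T x") auto
    then obtain y where y: "(?r, y) \<in> ?E ^^ k" "(y, x) \<in> ?E" using walk[of x] x by auto
    have "(?r, x) \<in> ?E ^^ Suc (ht T y)" using walk[of y] y EV by auto
    then have "Suc k \<le> Suc (ht T y)" using ht_le k by metis
    then show ?thesis using ht_le[OF y(1)] k y sym by (auto dest: symD)
  qed
  define p where "p x = (if x \<in> V - {?r} then SOME y. (x, y) \<in> ?E \<and> ht T x = Suc (ht T y) else x)" for x
  have pE: "(x, p x) \<in> ?E" and ph: "ht T x = Suc (ht T (p x))" if "x \<in> V - {?r}" for x
    using someI_ex[OF ex[OF that]] that by (auto simp: p_def)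
  have pV: "p x \<in> V" if "x \<in> V - {?r}" for x using pE[OF that] EV by auto
  have reach: "reaches p {?r} x" if "x \<in> V" for x
    using that
  proof (induction "ht T x" arbitrary: x rule: less_induct)
    case less
    then show ?case using ph[of x] pV[of x]
      by (cases "x = ?r") (auto intro: reaches.intros)
  qed
  let ?c = "\<lambda>v. card {w \<in> V - {?r}. p w = v}"
  have pf: "p \<in> forests V {?r} ?c"
    unfolding forests_def using reach pV by (auto simp: p_def)
  interpret P: parent_map V ?r ?c p using assms(1) r pf by unfold_locales
  have FE: "P.E \<subseteq> ?E" using pE symD[OF sym pE] by (auto simp: P.edge_iff)
  have "(u, v) \<in> P.E" if uv: "(u, v) \<in> ?E" for u v
  proof (rule ccontr)
    assume "(u, v) \<notin> P.E"
    moreover have "(u, v) \<in> P.E\<^sup>*" using P.connected EV uv by auto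
    moreover have "u \<noteq> v" "(v, u) \<in> ?E" using uv irr sym by (auto simp: irrefl_def dest: symD)
    ultimately show False using cycle_of_extra_edge[OF _ FE] acyc by blast
  qed
  then have "?E = P.E" using FE by auto
  then have Teq: "T = graph_of V ?r p" by (simp add: graph_of_def)
  have "?c v = c v" if "v \<in> V" for v
    using P.children_eq[OF that] cnt[OF that] Teq by simp
  then have "p \<in> forests V {?r} c" using pf by (auto simp: forests_def)
  then show ?thesis using Teq by blast
qed

lemma card_trees_of_height:
  assumes "finite V" "z \<in> V"
  shows "card {T \<in> trees_of V c. ht T z = h} =
    (\<Sum>r\<in>V. card {p \<in> forests V {r} c. depth p r z = h})"
proof -
  let ?B = "\<lambda>r. {p \<in> forests V {r} c. depth p r z = h}"
  have "{T \<in> trees_of V c. ht T z = h} = (\<Union>r\<in>V. graph_of V r ` ?B r)"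
  proof (intro set_eqI iffI)
    fix T assume T: "T \<in> {T \<in> trees_of V c. ht T z = h}"
    obtain p where p: "p \<in> forests V {troot T} c" "T = graph_of V (troot T) p"
      using graph_of_surj[OF assms(1)] T by blast
    have r: "troot T \<in> V" using T by (auto simp: trees_of_def rooted_tree_on_def)
    interpret P: parent_map V "troot T" c p using assms(1) r p by unfold_locales
    have "depth p (troot T) z = h" using P.ht_eq_depth[OF assms(2)] p(2) T by simp
    then show "T \<in> (\<Union>r\<in>V. graph_of V r ` ?B r)" using p r by blast
  next
    fix T assume "T \<in> (\<Union>r\<in>V. graph_of V r ` ?B r)"
    then obtain r p where r: "r \<in> V" and p: "p \<in> forests V {r} c" "depth p r z = h" "T = graph_of V r p"
      by blast
    interpret P: parent_map V r c p using assms(1) r p by unfold_locales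
    show "T \<in> {T \<in> trees_of V c. ht T z = h}"
      using P.in_trees_of P.ht_eq_depth[OF assms(2)] p by simp
  qed
  also have "card \<dots> = (\<Sum>r\<in>V. card (graph_of V r ` ?B r))"
  proof (rule card_UN_disjoint)
    show "\<forall>r\<in>V. \<forall>s\<in>V. r \<noteq> s \<longrightarrow> graph_of V r ` ?B r \<inter> graph_of V s ` ?B s = {}"
      by (auto simp: graph_of_def)
  qed (use assms in \<open>simp_all add: finite_forests\<close>)
  also have "\<dots> = (\<Sum>r\<in>V. card (?B r))"
    using assms by (intro sum.cong card_image refl inj_on_subset[OF inj_on_graph_of]) auto
  finally show ?thesis .
qed

section \<open>Trees with a marked leaf at a given height\<close>

lemma depth_eq_iff:
  assumes "reaches p {r} z"
  shows "depth p r z = h \<longleftrightarrow> (p ^^ h) z = r \<and> (\<forall>i<h. (p ^^ i) z \<noteq> r)"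
proof -
  obtain k where k: "(p ^^ k) z = r" using reaches_funpow[OF assms] by blast
  show ?thesis
  proof
    assume "depth p r z = h"
    then show "(p ^^ h) z = r \<and> (\<forall>i<h. (p ^^ i) z \<noteq> r)"
      unfolding depth_def using LeastI[of "\<lambda>k. (p ^^ k) z = r", OF k] not_less_Least by blast
  next
    assume "(p ^^ h) z = r \<and> (\<forall>i<h. (p ^^ i) z \<noteq> r)"
    then show "depth p r z = h"
      unfolding depth_def by (intro Least_equality) (auto simp: not_less[symmetric])
  qed
qed

lemma forests_at_depth:
  assumes "z \<in> V"
  shows "{p \<in> forests V {r} c. depth p r z = h} = forests_at V {r} c z r h"
proof -
  have reach: "reaches p {r} z" if "p \<in> forests V {r} c" for p
    using that assms by (cases "z = r") (auto simp: forests_def intro: reaches.here)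
  show ?thesis unfolding forests_at_def
    by (intro Collect_cong conj_cong refl) (simp add: depth_eq_iff[OF reach])
qed

text \<open>The case of a single root \<open>r\<close> in \<open>card_forests_at\<close>, summed over \<open>r\<close>. Now \<open>A\<close> is the set of
all vertices on the path from the root to \<open>z\<close> other than \<open>z\<close> itself, the root included.\<close>
lemma card_trees_of_height_weight:
  assumes "finite V" "z \<in> V" "c z = 0" "(\<Sum>v\<in>V. c v) = card (V - {z})" "V \<noteq> {z}"
  shows "real (card {T \<in> trees_of V c. ht T z = h}) * (\<Prod>v\<in>V. fact (c v)) =
    fact h * (\<Sum>A\<in>subsets_of_card h (V - {z}). (\<Prod>v\<in>A. real (c v)) *
      forest_weight (card (V - {z}) - h) (\<Sum>v\<in>A. real (c v) - 1))"
proof -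
  have cV: "card (V - {r}) = card (V - {z})" if "r \<in> V" for r
    using assms that by simp
  have lhs: "card {T \<in> trees_of V c. ht T z = h} = (\<Sum>r\<in>V. card (forests_at V {r} c z r h))"
    by (simp only: card_trees_of_height[OF assms(1,2)] forests_at_depth[OF assms(2)])
  have pos: "card (V - {z}) \<noteq> 0" using assms(1,2,5) card_eq_0_iff[of "V - {z}"] by blast
  show ?thesis
  proof (cases h)
    case 0
    have "real (card (forests V {z} c)) * (\<Prod>v\<in>V. fact (c v)) = 0"
      using card_forests[of V "{z}" c] assms pos by (simp add: forest_weight_def)
    then have "real (card (forests V {z} c)) = 0" using assms by (simp add: prod_zero_iff)
    moreover have "(\<Sum>r\<in>V. card (forests_at V {r} c z r 0)) = card (forests V {z} c)"
      using assms by (simp add: forests_at_0 if_distrib cong: if_cong)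
    moreover have "subsets_of_card 0 (V - {z}) = {{}}"
      using assms(1) by (simp add: subsets_of_card_0)
    ultimately show ?thesis using lhs 0 pos by (simp add: forest_weight_def)
  next
    case (Suc k)
    define f where "f A = (\<Prod>v\<in>A. real (c v)) * forest_weight (card (V - {z}) - h) (\<Sum>v\<in>A. real (c v) - 1)" for A
    let ?X = "V - {z}"
    have finX: "finite ?X" using assms by simp
    have r: "real (card (forests_at V {r} c z r h)) * (\<Prod>v\<in>V. fact (c v)) =
      fact k * (\<Sum>A\<in>subsets_of_card k (?X - {r}). f (insert r A))" if r: "r \<in> ?X" for r
    proof -
      have "real (card (forests_at V {r} c z r h)) * (\<Prod>v\<in>V. fact (c v)) =
        fact k * real (c r) * (\<Sum>A\<in>subsets_of_card k (V - {r} - {z}). (\<Prod>v\<in>A. real (c v)) *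
         forest_weight (card (V - {r}) - h) ((\<Sum>v\<in>{r}. real (c v)) - 1 + (\<Sum>v\<in>A. real (c v) - 1) + c z))"
        unfolding Suc using assms r by (intro card_forests_at) (auto simp: cV)
      also have "V - {r} - {z} = ?X - {r}" by auto
      also have "card (V - {r}) = card ?X" using cV r by blast
      also have "fact k * real (c r) * (\<Sum>A\<in>subsets_of_card k (?X - {r}). (\<Prod>v\<in>A. real (c v)) *
         forest_weight (card ?X - h) ((\<Sum>v\<in>{r}. real (c v)) - 1 + (\<Sum>v\<in>A. real (c v) - 1) + c z))
        = fact k * (\<Sum>A\<in>subsets_of_card k (?X - {r}). real (c r) * ((\<Prod>v\<in>A. real (c v)) *
         forest_weight (card ?X - h) ((\<Sum>v\<in>{r}. real (c v)) - 1 + (\<Sum>v\<in>A. real (c v) - 1) + c z)))"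
        by (simp only: sum_distrib_left mult.assoc)
      also have "\<dots> = fact k * (\<Sum>A\<in>subsets_of_card k (?X - {r}). f (insert r A))"
      proof -
        have "real (c r) * ((\<Prod>v\<in>A. real (c v)) *
         forest_weight (card ?X - h) ((\<Sum>v\<in>{r}. real (c v)) - 1 + (\<Sum>v\<in>A. real (c v) - 1) + c z)) = f (insert r A)"
          if A: "A \<in> subsets_of_card k (?X - {r})" for A
        proof -
          have "finite A" "r \<notin> A" using A finX by (auto simp: subsets_of_card_def dest: finite_subset)
          then show ?thesis using assms by (simp add: f_def)
        qed
        then show ?thesis by simp
      qed
      finally show ?thesis .
    qed
    have "card {T \<in> trees_of V c. ht T z = h} = (\<Sum>r\<in>?X. card (forests_at V {r} c z r h))"
      unfolding lhs using assms(1,2) by (simp add: sum.remove[where x = z] forests_at_root Suc)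
    then have "real (card {T \<in> trees_of V c. ht T z = h}) * (\<Prod>v\<in>V. fact (c v)) =
      (\<Sum>r\<in>?X. fact k * (\<Sum>A\<in>subsets_of_card k (?X - {r}). f (insert r A)))"
      using r by (simp add: sum_distrib_right)
    also have "\<dots> = fact (Suc k) * (\<Sum>A\<in>subsets_of_card (Suc k) ?X. f A)"
      by (simp only: sum_distrib_left[symmetric] sum_insert_subsets[OF finX] fact_Suc mult_ac)
    finally show ?thesis by (simp add: f_def Suc del: fact_Suc)
  qed
qed

text \<open>The factor of the number of trees with a marked leaf at depth \<open>h\<close> that depends on the child
counts: a sum over the possible sets \<open>A\<close> of proper ancestors of the leaf.\<close>
definition spine_sum :: "'a set \<Rightarrow> ('a \<Rightarrow> nat) \<Rightarrow> nat \<Rightarrow> real" where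
  "spine_sum X c h = (\<Sum>A\<in>subsets_of_card h X. (\<Sum>v\<in>A. real (c v) - 1) * (\<Prod>v\<in>A. real (c v)))"

lemma spine_children_ge:
  assumes "finite X" "one_free_seq X c" "A \<in> subsets_of_card h X" "(\<Prod>v\<in>A. real (c v)) \<noteq> 0"
  shows "2 * h \<le> (\<Sum>v\<in>A. c v)" "0 \<le> (\<Sum>v\<in>A. real (c v) - 1)" "(\<Sum>v\<in>A. c v) \<le> (\<Sum>v\<in>X. c v)"
proof -
  have A: "finite A" "A \<subseteq> X" "card A = h" using assms by (auto simp: subsets_of_card_def dest: finite_subset)
  have c2: "2 \<le> c v" if "v \<in> A" for v
  proof -
    have "c v \<noteq> 0" using assms(4) that A by (auto simp: prod_zero_iff)
    moreover have "c v \<noteq> 1" using assms(2) that A by (auto simp: one_free_seq_def)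
    ultimately show ?thesis by linarith
  qed
  then have "(\<Sum>v\<in>A. 2) \<le> (\<Sum>v\<in>A. c v)" by (rule sum_mono)
  then show "2 * h \<le> (\<Sum>v\<in>A. c v)" using A by simp
  show "0 \<le> (\<Sum>v\<in>A. real (c v) - 1)" using c2 by (intro sum_nonneg) (fastforce simp: of_nat_diff)
  show "(\<Sum>v\<in>A. c v) \<le> (\<Sum>v\<in>X. c v)" using A assms by (intro sum_mono2) auto
qed

text \<open>Proper ancestors of \<open>z\<close> have at least two children each, so they make up at most half of the vertices
other than \<open>z\<close>; hence the exceptional value of \<open>forest_weight\<close> at 0 does not occur with a nonzero
factor.\<close>
lemma card_trees_of_height_spine_sum:
  assumes "finite V" "z \<in> V" "c z = 0" "(\<Sum>v\<in>V. c v) = card (V - {z})" "V \<noteq> {z}" "one_free_seq V c"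
  shows "real (card {T \<in> trees_of V c. ht T z = h}) * (\<Prod>v\<in>V. fact (c v)) =
    fact h * fact (card (V - {z}) - 1 - h) * spine_sum (V - {z}) c h"
proof -
  let ?n = "card (V - {z})"
  have n: "(\<Sum>v\<in>V - {z}. c v) = ?n" using assms by (simp add: sum.remove[of V z])
  have pos: "?n \<noteq> 0" using assms(1,2,5) card_eq_0_iff[of "V - {z}"] by blast
  have of1: "one_free_seq (V - {z}) c" using assms by (auto simp: one_free_seq_def)
  have "(\<Prod>v\<in>A. real (c v)) * forest_weight (?n - h) (\<Sum>v\<in>A. real (c v) - 1) =
     fact (?n - 1 - h) * ((\<Sum>v\<in>A. real (c v) - 1) * (\<Prod>v\<in>A. real (c v)))"
    if A: "A \<in> subsets_of_card h (V - {z})" for A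
  proof (cases "(\<Prod>v\<in>A. real (c v)) = 0")
    case False
    have "2 * h \<le> ?n" using spine_children_ge[OF _ of1 A False] assms n by auto
    then show ?thesis using pos by (simp add: forest_weight_def diff_commute)
  qed simp
  then have "(\<Sum>A\<in>subsets_of_card h (V - {z}). (\<Prod>v\<in>A. real (c v)) * forest_weight (?n - h) (\<Sum>v\<in>A. real (c v) - 1))
    = fact (?n - 1 - h) * spine_sum (V - {z}) c h"
    unfolding spine_sum_def sum_distrib_left by (rule sum.cong[OF refl])
  then show ?thesis unfolding card_trees_of_height_weight[OF assms(1-5)] by simp
qed

text \<open>Both sides count the same thing: remove each element \<open>y\<close> in turn from a set of size \<open>h + 1\<close>. The
sum \<open>S A\<close> of all \<open>c v - 1\<close> satisfies \<open>(\<Sum>y\<in>A. S (A - {y})) = h * S A\<close>, and conversely a set of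
size \<open>h\<close> is extended by the vertices outside it, with total weight the sum of their child counts.\<close>
lemma spine_sum_Suc:
  assumes "finite X"
  shows "h * spine_sum X c (Suc h) = (\<Sum>A\<in>subsets_of_card h X.
    (\<Sum>v\<in>A. real (c v) - 1) * (\<Prod>v\<in>A. real (c v)) * ((\<Sum>v\<in>X. real (c v)) - (\<Sum>v\<in>A. real (c v))))"
proof -
  define S where "S A = (\<Sum>v\<in>A. real (c v) - 1)" for A
  define P where "P A = (\<Prod>v\<in>A. real (c v))" for A
  have fin: "finite A" if "A \<subseteq> X" for A using assms that finite_subset by blast
  have "h * spine_sum X c (Suc h) = (\<Sum>A\<in>subsets_of_card (Suc h) X. \<Sum>y\<in>A. c y * (S (A - {y}) * P (A - {y})))"
    unfolding spine_sum_def sum_distrib_left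
  proof (rule sum.cong)
    fix A assume "A \<in> subsets_of_card (Suc h) X"
    then have A: "finite A" "card A = Suc h" using fin by (auto simp: subsets_of_card_def)
    have "(\<Sum>y\<in>A. c y * (S (A - {y}) * P (A - {y}))) = (\<Sum>y\<in>A. (S A - (real (c y) - 1)) * P A)"
      using A by (intro sum.cong) (simp_all add: S_def P_def sum_diff1 prod.remove)
    also have "\<dots> = ((\<Sum>y\<in>A. S A) - S A) * P A"
      unfolding S_def by (simp only: sum_distrib_right[symmetric] sum_subtractf)
    also have "\<dots> = h * (S A * P A)"
      using A by (simp add: algebra_simps)
    finally show "h * ((\<Sum>v\<in>A. real (c v) - 1) * (\<Prod>v\<in>A. real (c v))) = (\<Sum>y\<in>A. c y * (S (A - {y}) * P (A - {y})))"
      by (simp add: S_def P_def)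
  qed simp
  also have "\<dots> = (\<Sum>y\<in>X. \<Sum>A\<in>subsets_of_card h (X - {y}). c y * (S A * P A))"
    by (rule sum_pointed_subsets[OF assms, symmetric])
  also have "\<dots> = (\<Sum>y\<in>X. \<Sum>A\<in>subsets_of_card h X. if y \<notin> A then c y * (S A * P A) else 0)"
  proof (rule sum.cong)
    fix y assume "y \<in> X"
    have "subsets_of_card h (X - {y}) = subsets_of_card h X \<inter> {A. y \<notin> A}" by (auto simp: subsets_of_card_def)
    then show "(\<Sum>A\<in>subsets_of_card h (X - {y}). c y * (S A * P A)) =
      (\<Sum>A\<in>subsets_of_card h X. if y \<notin> A then c y * (S A * P A) else 0)"
      using assms by (simp add: sum.inter_restrict finite_subsets_of_card if_distrib cong: if_cong)
  qed simp
  also have "\<dots> = (\<Sum>A\<in>subsets_of_card h X. \<Sum>y\<in>X. if y \<notin> A then c y * (S A * P A) else 0)"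
    by (rule sum.swap)
  also have "\<dots> = (\<Sum>A\<in>subsets_of_card h X. S A * P A * ((\<Sum>v\<in>X. real (c v)) - (\<Sum>v\<in>A. real (c v))))"
  proof (rule sum.cong)
    fix A assume "A \<in> subsets_of_card h X"
    then have A: "A \<subseteq> X" by (auto simp: subsets_of_card_def)
    have "(\<Sum>y\<in>X. if y \<notin> A then c y * (S A * P A) else 0) = (\<Sum>y\<in>X - A. c y * (S A * P A))"
      using assms by (intro sum.mono_neutral_cong_right) auto
    also have "\<dots> = S A * P A * (\<Sum>y\<in>X - A. real (c y))"
      by (simp only: sum_distrib_left mult_ac)
    also have "(\<Sum>y\<in>X - A. real (c y)) = (\<Sum>v\<in>X. real (c v)) - (\<Sum>v\<in>A. real (c v))"
      using A assms by (simp add: sum_diff fin)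
    finally show "(\<Sum>y\<in>X. if y \<notin> A then c y * (S A * P A) else 0) =
      S A * P A * ((\<Sum>v\<in>X. real (c v)) - (\<Sum>v\<in>A. real (c v)))" .
  qed simp
  finally show ?thesis by (simp add: S_def P_def)
qed

text \<open>The \<open>h\<close> ancestors have at least \<open>2 * h\<close> children in total, with equality for binary trees, where
the inequality therefore becomes the identity of the next lemma.\<close>
lemma spine_sum_Suc_le:
  assumes "finite X" "one_free_seq X c"
  shows "h * spine_sum X c (Suc h) \<le> ((\<Sum>v\<in>X. real (c v)) - 2 * real h) * spine_sum X c h"
  unfolding spine_sum_Suc[OF assms(1)]
  unfolding spine_sum_def sum_distrib_left
proof (rule sum_mono)
  fix A assume A: "A \<in> subsets_of_card h X"
  let ?S = "\<Sum>v\<in>A. real (c v) - 1" and ?P = "\<Prod>v\<in>A. real (c v)"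
  show "?S * ?P * ((\<Sum>v\<in>X. real (c v)) - (\<Sum>v\<in>A. real (c v))) \<le> ((\<Sum>v\<in>X. real (c v)) - 2 * real h) * (?S * ?P)"
  proof (cases "?P = 0")
    case False
    note ge = spine_children_ge[OF assms A False]
    have "0 \<le> ?P" by (intro prod_nonneg) simp
    moreover have "real (2 * h) \<le> real (\<Sum>v\<in>A. c v)" using ge(1) of_nat_le_iff by blast
    ultimately show ?thesis using ge(2)
      by (subst mult.commute) (intro mult_right_mono, auto)
  qed simp
qed

lemma spine_sum_Suc_binary:
  assumes "finite X" "binary_seq X c"
  shows "h * spine_sum X c (Suc h) = ((\<Sum>v\<in>X. real (c v)) - 2 * real h) * spine_sum X c h"
  unfolding spine_sum_Suc[OF assms(1)]
  unfolding spine_sum_def sum_distrib_left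
proof (rule sum.cong)
  fix A assume A: "A \<in> subsets_of_card h X"
  let ?S = "\<Sum>v\<in>A. real (c v) - 1" and ?P = "\<Prod>v\<in>A. real (c v)"
  show "?S * ?P * ((\<Sum>v\<in>X. real (c v)) - (\<Sum>v\<in>A. real (c v))) = ((\<Sum>v\<in>X. real (c v)) - 2 * real h) * (?S * ?P)"
  proof (cases "?P = 0")
    case False
    have fA: "finite A" "A \<subseteq> X" "card A = h" using A assms by (auto simp: subsets_of_card_def dest: finite_subset)
    have "c v = 2" if "v \<in> A" for v
    proof -
      have "c v \<noteq> 0" using False that fA by (auto simp: prod_zero_iff)
      then show ?thesis using assms(2) subsetD[OF fA(2) that] by (auto simp: binary_seq_def)
    qed
    then have "(\<Sum>v\<in>A. real (c v)) = 2 * real h" using fA by simp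
    then show ?thesis by (simp only: mult.commute)
  qed simp
qed simp

lemma spine_term_nonneg:
  assumes "finite X" "one_free_seq X c" "A \<in> subsets_of_card h X"
  shows "0 \<le> (\<Sum>v\<in>A. real (c v) - 1) * (\<Prod>v\<in>A. real (c v))"
proof (cases "(\<Prod>v\<in>A. real (c v)) = 0")
  case False
  then show ?thesis
    using spine_children_ge(2)[OF assms] by (intro mult_nonneg_nonneg prod_nonneg) auto
qed simp

lemma spine_sum_nonneg:
  assumes "finite X" "one_free_seq X c"
  shows "0 \<le> spine_sum X c h"
  unfolding spine_sum_def by (intro sum_nonneg spine_term_nonneg[OF assms])

lemma spine_sum_eq_0:
  assumes "finite X" "one_free_seq X c" "(\<Sum>v\<in>X. c v) < 2 * h"
  shows "spine_sum X c h = 0"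
  unfolding spine_sum_def
proof (rule sum.neutral, rule ballI)
  fix A assume "A \<in> subsets_of_card h X"
  then show "(\<Sum>v\<in>A. real (c v) - 1) * (\<Prod>v\<in>A. real (c v)) = 0"
    using spine_children_ge(1,3)[OF assms(1,2)] assms(3) by fastforce
qed

lemma spine_sum_binary_pos:
  assumes "finite X" "binary_seq X c" "0 < h" "2 * h \<le> (\<Sum>v\<in>X. c v)"
  shows "0 < spine_sum X c h"
  using assms(3,4)
proof (induction h)
  case (Suc h)
  have of1: "one_free_seq X c" using assms by (auto simp: binary_seq_def one_free_seq_def)
  show ?case
  proof (cases "h = 0")
    case True
    obtain v where v: "v \<in> X" "c v \<noteq> 0" using Suc.prems by (metis not_numeral_le_zero mult_Suc_right add_is_0 le_zero_eq sum.neutral)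
    then have "c v = 2" using assms(2) by (auto simp: binary_seq_def)
    then show ?thesis unfolding spine_sum_def True
    proof (intro sum_pos2[where i = "{v}"])
      fix A assume "A \<in> subsets_of_card (Suc 0) X"
      then show "0 \<le> (\<Sum>v\<in>A. real (c v) - 1) * (\<Prod>v\<in>A. real (c v))"
        by (rule spine_term_nonneg[OF assms(1) of1])
    qed (use v assms finite_subsets_of_card in \<open>auto simp: subsets_of_card_def\<close>)
  next
    case False
    have "real h * spine_sum X c (Suc h) = ((\<Sum>v\<in>X. real (c v)) - 2 * real h) * spine_sum X c h"
      by (rule spine_sum_Suc_binary[OF assms(1,2)])
    moreover have "0 < spine_sum X c h" using Suc False by simp
    moreover have "real (2 * h) < real (\<Sum>v\<in>X. c v)" using Suc.prems by (subst of_nat_less_iff) simp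
    then have "0 < (\<Sum>v\<in>X. real (c v)) - 2 * real h" by simp
    ultimately have "0 < real h * spine_sum X c (Suc h)" by (simp add: mult_pos_pos)
    then show ?thesis using False by (simp add: zero_less_mult_iff)
  qed
qed simp

section \<open>Stochastic order from monotone likelihood ratios\<close>

text \<open>The condition \<open>supp\<close> keeps the intermediate values of \<open>b\<close> nonzero for as long as \<open>a\<close> has a nonzero
value ahead, so that they can be cancelled when consecutive comparisons are multiplied.\<close>
lemma likelihood_ratio_chain:
  fixes a b :: "nat \<Rightarrow> real"
  assumes a0: "\<And>h. 0 \<le> a h" and b0: "\<And>h. 0 \<le> b h"
    and step: "\<And>h. 0 < h \<Longrightarrow> a (Suc h) * b h \<le> a h * b (Suc h)"
    and supp: "\<And>h. 0 < h \<Longrightarrow> a (Suc h) \<noteq> 0 \<Longrightarrow> b h \<noteq> 0"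
    and "0 < i" "i < j"
  shows "a j * b i \<le> a i * b j"
  using \<open>i < j\<close>
proof (induction j)
  case (Suc j)
  show ?case
  proof (cases "i = j \<or> a (Suc j) = 0")
    case True then show ?thesis using step[OF \<open>0 < i\<close>] a0 b0 by auto
  next
    case False
    then have ij: "i < j" using Suc.prems by simp
    have bj: "0 < b j" using supp[of j] False ij b0[of j] by simp
    have "a (Suc j) * b i * b j \<le> a j * b (Suc j) * b i"
      using mult_right_mono[OF step[of j] b0[of i]] ij by (simp add: mult_ac)
    also have "\<dots> \<le> a i * b j * b (Suc j)"
      using mult_right_mono[OF Suc.IH[OF ij] b0[of "Suc j"]] by (simp add: mult_ac)
    finally have "(a (Suc j) * b i) * b j \<le> (a i * b (Suc j)) * b j" by (simp add: mult_ac)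
    then show ?thesis using bj by simp
  qed
qed simp

text \<open>A monotone likelihood ratio implies stochastic order: summing \<open>ratio\<close> over all \<open>j\<close> above and all
\<open>i\<close> below the threshold compares the odds of exceeding it.\<close>
lemma stoch_le_of_likelihood_ratio:
  fixes f :: "'a \<Rightarrow> nat" and g :: "'b \<Rightarrow> nat"
  assumes fin: "finite S" "finite S'" and ne: "S \<noteq> {}" "S' \<noteq> {}"
    and ratio: "\<And>i j. i < j \<Longrightarrow> card {s \<in> S. f s = j} * card {s \<in> S'. g s = i}
       \<le> card {s \<in> S. f s = i} * card {s \<in> S'. g s = j}"
  shows "map_pmf (\<lambda>s. real (f s)) (pmf_of_set S) \<preceq>\<^sub>s\<^sub>t map_pmf (\<lambda>s. real (g s)) (pmf_of_set S')"
  unfolding stoch_le_def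
proof
  fix x :: real
  define k where "k = nat \<lceil>x\<rceil>"
  have k: "x \<le> real m \<longleftrightarrow> k \<le> m" for m unfolding k_def by linarith
  have prob: "measure_pmf.prob (map_pmf (\<lambda>s. real (f s)) (pmf_of_set S)) {x..} = card {s \<in> S. k \<le> f s} / card S"
    if "finite S" "S \<noteq> {}" for S :: "'c set" and f :: "'c \<Rightarrow> nat"
    using that by (simp add: measure_pmf_of_set vimage_def k Int_def)
  obtain M where M: "\<And>s. s \<in> S \<Longrightarrow> f s \<le> M" "\<And>s. s \<in> S' \<Longrightarrow> g s \<le> M"
  proof -
    have "finite (f ` S \<union> g ` S')" using fin by simp
    then obtain M where "\<forall>x\<in>f ` S \<union> g ` S'. x \<le> M" using finite_nat_set_iff_bounded_le by blast
    then show ?thesis using that by blast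
  qed
  have up: "card {s \<in> S. k \<le> f s} = (\<Sum>j\<in>{k..M}. card {s \<in> S. f s = j})"
    if "finite S" "\<And>s. s \<in> S \<Longrightarrow> f s \<le> M" for S :: "'c set" and f :: "'c \<Rightarrow> nat"
  proof -
    have "{s \<in> S. k \<le> f s} = (\<Union>j\<in>{k..M}. {s \<in> S. f s = j})" using that by auto
    then show ?thesis using that(1) by (simp only:) (rule card_UN_disjoint, auto)
  qed
  have low: "card {s \<in> S. f s < k} = (\<Sum>j\<in>{..<k}. card {s \<in> S. f s = j})"
    if "finite S" for S :: "'c set" and f :: "'c \<Rightarrow> nat"
  proof -
    have "{s \<in> S. f s < k} = (\<Union>j\<in>{..<k}. {s \<in> S. f s = j})" using that by auto
    then show ?thesis using that(1) by (simp only:) (rule card_UN_disjoint, auto)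
  qed
  have tot: "card S = card {s \<in> S. f s < k} + card {s \<in> S. k \<le> f s}"
    if "finite S" for S :: "'c set" and f :: "'c \<Rightarrow> nat"
  proof -
    have "S = {s \<in> S. f s < k} \<union> {s \<in> S. k \<le> f s}" by auto
    also have "card \<dots> = card {s \<in> S. f s < k} + card {s \<in> S. k \<le> f s}"
      using that by (intro card_Un_disjoint) auto
    finally show ?thesis .
  qed
  have "card {s \<in> S. k \<le> f s} * card {s \<in> S'. g s < k} \<le> card {s \<in> S. f s < k} * card {s \<in> S'. k \<le> g s}"
  proof -
    have "card {s \<in> S. k \<le> f s} * card {s \<in> S'. g s < k} =
      (\<Sum>j\<in>{k..M}. \<Sum>i\<in>{..<k}. card {s \<in> S. f s = j} * card {s \<in> S'. g s = i})"
      using up[OF fin(1) M(1)] low[OF fin(2)] by (simp add: sum_product)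
    also have "\<dots> \<le> (\<Sum>j\<in>{k..M}. \<Sum>i\<in>{..<k}. card {s \<in> S. f s = i} * card {s \<in> S'. g s = j})"
      by (intro sum_mono ratio) auto
    also have "\<dots> = (\<Sum>i\<in>{..<k}. \<Sum>j\<in>{k..M}. card {s \<in> S. f s = i} * card {s \<in> S'. g s = j})"
      by (rule sum.swap)
    also have "\<dots> = card {s \<in> S. f s < k} * card {s \<in> S'. k \<le> g s}"
      using low[OF fin(1)] up[OF fin(2) M(2)] by (simp add: sum_product)
    finally show ?thesis .
  qed
  then have "card {s \<in> S. k \<le> f s} * card S' \<le> card {s \<in> S'. k \<le> g s} * card S"
    using tot[OF fin(1), of f] tot[OF fin(2), of g] by (simp add: algebra_simps)
  then have "real (card {s \<in> S. k \<le> f s}) * real (card S') \<le> real (card {s \<in> S'. k \<le> g s}) * real (card S)"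
    by (simp flip: of_nat_mult)
  moreover have "0 < real (card S)" "0 < real (card S')" using fin ne by (simp_all add: card_gt_0_iff)
  ultimately show "measure_pmf.prob (map_pmf (\<lambda>s. real (f s)) (pmf_of_set S)) {x..}
     \<le> measure_pmf.prob (map_pmf (\<lambda>s. real (g s)) (pmf_of_set S')) {x..}"
    unfolding prob[OF fin(1) ne(1)] prob[OF fin(2) ne(2)] by (simp add: divide_simps)
qed

section \<open>Comparison of the heights\<close>

lemma card_marked_trees_of_height:
  assumes "finite V"
  shows "card {s \<in> marked_trees m V c z. ht (fst s) z = h} =
    card {T \<in> trees_of V c. ht T z = h} * card (weak_compositions m h)"
proof -
  have "{s \<in> marked_trees m V c z. ht (fst s) z = h} = {T \<in> trees_of V c. ht T z = h} \<times> weak_compositions m h"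
    by (auto simp: marked_trees_def)
  then show ?thesis by (simp add: card_cartesian_product)
qed

lemma sum_children:
  assumes "finite V" "trees_of V c \<noteq> {}" "z \<in> V"
  shows "(\<Sum>v\<in>V. c v) = card (V - {z})"
proof -
  obtain T where T: "T \<in> trees_of V c" using assms by blast
  then have r: "troot T \<in> V" by (auto simp: trees_of_def rooted_tree_on_def)
  obtain p where "p \<in> forests V {troot T} c" using graph_of_surj[OF assms(1) T] by blast
  then show ?thesis using sum_child_counts[OF assms(1)] r assms by simp
qed

theorem theorem1p8:
  fixes m n :: nat and c b :: "nat \<Rightarrow> nat"
  assumes "0 < m" and "0 < n"
    and "child_sequence {0..n} c" and "one_free_seq {0..n} c" and "c 0 = 0"
    and "child_sequence {0..n + n mod 2} b" and "binary_seq {0..n + n mod 2} b" and "b 0 = 0"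
    and "trees_of {0..n} c \<noteq> {}" and "trees_of {0..n + n mod 2} b \<noteq> {}"
  shows "map_pmf (\<lambda>(T, P). real (ht T 0)) (pmf_of_set (marked_trees m {0..n} c 0))
         \<preceq>\<^sub>s\<^sub>t map_pmf (\<lambda>(S, Q). real (ht S 0)) (pmf_of_set (marked_trees m {0..n + n mod 2} b 0))"
proof -
  let ?n = "n + n mod 2"
  let ?V = "{0..n}" and ?W = "{0..?n}"
  let ?X = "?V - {0}" and ?Y = "?W - {0}"
  have c1: "one_free_seq ?V c" "one_free_seq ?X c" using assms by (auto simp: one_free_seq_def)
  have b2: "binary_seq ?Y b" and b1: "one_free_seq ?W b" "one_free_seq ?Y b"
    using assms(7) by (auto simp: one_free_seq_def binary_seq_def)
  have sV: "(\<Sum>v\<in>?V. c v) = card ?X" and sW: "(\<Sum>v\<in>?W. b v) = card ?Y"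
    using sum_children[of ?V c 0] sum_children[of ?W b 0] assms by auto
  have cX: "card ?X = n" and cY: "card ?Y = ?n" by auto
  have sX: "(\<Sum>v\<in>?X. c v) = n" and sY: "(\<Sum>v\<in>?Y. b v) = ?n"
    using sV sW assms(5,8) cX cY by (simp_all add: sum.remove[of _ 0])
  have rX: "(\<Sum>v\<in>?X. real (c v)) = n" and rY: "(\<Sum>v\<in>?Y. real (b v)) = ?n"
    using arg_cong[OF sX, of real] arg_cong[OF sY, of real] by (simp_all only: of_nat_sum)
  define e where "e = spine_sum ?X c"
  define f where "f = spine_sum ?Y b"
  have e0: "0 \<le> e h" and f0: "0 \<le> f h" for h
    unfolding e_def f_def by (intro spine_sum_nonneg c1 b1; simp)+
  have e_step: "h * e (Suc h) \<le> (real n - 2 * real h) * e h" for h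
    unfolding e_def using spine_sum_Suc_le[of ?X c h] c1 rX by simp
  have f_step: "h * f (Suc h) = (real ?n - 2 * real h) * f h" for h
    unfolding f_def using spine_sum_Suc_binary[of ?Y b h] b2 rY by simp
  have e_supp: "2 * h \<le> n" if "e h \<noteq> 0" for h
    using that spine_sum_eq_0[of ?X c h] c1 sX unfolding e_def by fastforce
  define K where "K = (\<Prod>v\<in>?V. fact (c v) :: real)"
  define L where "L = (\<Prod>v\<in>?W. fact (b v) :: real)"
  have K: "0 < K" and L: "0 < L" unfolding K_def L_def by (auto intro: prod_pos)
  define M where "M h = real (card {T \<in> trees_of ?V c. ht T 0 = h})" for h
  define N where "N h = real (card {T \<in> trees_of ?W b. ht T 0 = h})" for h
  have M: "M h * K = fact h * fact (n - 1 - h) * e h" for h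
    unfolding M_def K_def e_def using card_trees_of_height_spine_sum[of ?V 0 c h] assms c1 sV cX by auto
  have N: "N h * L = fact h * fact (?n - 1 - h) * f h" for h
    unfolding N_def L_def f_def using card_trees_of_height_spine_sum[of ?W 0 b h] assms b1 sW cY by auto
  have step: "M (Suc h) * N h \<le> M h * N (Suc h)" if h: "0 < h" for h
  proof (cases "e (Suc h) = 0")
    case True
    then have "M (Suc h) = 0" using M[of "Suc h"] K by simp
    then show ?thesis by (simp add: M_def N_def)
  next
    case False
    then have hn: "2 * Suc h \<le> n" by (rule e_supp)
    have fe: "(fact (n - 1 - h) :: real) = (real n - 1 - h) * fact (n - 1 - Suc h)"
      using hn by (subst fact_reduce) (auto simp: of_nat_diff)
    have ff: "(fact (?n - 1 - h) :: real) = (real ?n - 1 - h) * fact (?n - 1 - Suc h)"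
      using hn by (subst fact_reduce) (auto simp: of_nat_diff)
    \<comment> \<open>For odd \<open>n\<close> the difference of the two sides is \<open>h - 1\<close>; for even \<open>n\<close> they agree.\<close>
    have coef: "(real n - 2 * real h) * (real ?n - 1 - h) \<le> (real n - 1 - h) * (real ?n - 2 * real h)"
    proof (cases "even n")
      case False
      then have "n mod 2 = 1" by presburger
      then show ?thesis using h by (simp add: algebra_simps)
    qed simp
    have "h * (e (Suc h) * ((real ?n - 1 - h) * f h)) \<le> (real n - 2 * real h) * e h * ((real ?n - 1 - h) * f h)"
      using mult_right_mono[OF e_step[of h], of "(real ?n - 1 - h) * f h"] f0[of h] hn by (simp add: mult.assoc)
    also have "\<dots> = ((real n - 2 * real h) * (real ?n - 1 - h)) * (e h * f h)" by (simp only: mult_ac)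
    also have "\<dots> \<le> ((real n - 1 - h) * (real ?n - 2 * real h)) * (e h * f h)"
      using coef e0 f0 by (intro mult_right_mono) auto
    also have "\<dots> = h * ((real n - 1 - h) * e h * f (Suc h))"
      using f_step[of h] by (simp add: mult_ac)
    finally have main: "e (Suc h) * ((real ?n - 1 - h) * f h) \<le> (real n - 1 - h) * e h * f (Suc h)"
      using h by simp
    define R :: real where "R = fact h * fact (Suc h) * fact (n - 1 - Suc h) * fact (?n - 1 - Suc h)"
    have R: "0 \<le> R" by (simp add: R_def)
    have "(M (Suc h) * N h) * (K * L) = (M (Suc h) * K) * (N h * L)" by (simp only: mult_ac)
    also have "\<dots> = R * (e (Suc h) * ((real ?n - 1 - h) * f h))"
      unfolding M N ff R_def by (simp only: mult_ac)
    also have "\<dots> \<le> R * ((real n - 1 - h) * e h * f (Suc h))" using main R by (rule mult_left_mono)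
    also have "\<dots> = (M h * K) * (N (Suc h) * L)" unfolding M N fe R_def by (simp only: mult_ac)
    also have "\<dots> = (M h * N (Suc h)) * (K * L)" by (simp only: mult_ac)
    finally show ?thesis using K L by simp
  qed
  have supp: "N h \<noteq> 0" if "0 < h" "M (Suc h) \<noteq> 0" for h
  proof -
    have "e (Suc h) \<noteq> 0" using M[of "Suc h"] that K by auto
    then have "2 * h \<le> ?n" using e_supp[of "Suc h"] by simp
    then have "0 < f h" unfolding f_def using spine_sum_binary_pos[of ?Y b h] b2 sY that by simp
    then show ?thesis using N[of h] L by auto
  qed
  have "e 0 = 0" "f 0 = 0"
    by (simp_all add: e_def f_def spine_sum_def subsets_of_card_0)
  then have "M 0 = 0" "N 0 = 0" using M[of 0] N[of 0] K L by simp_all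
  then have MN: "M j * N i \<le> M i * N j" if "i < j" for i j
    using likelihood_ratio_chain[of M N i j] step supp that by (cases "i = 0") (auto simp: M_def N_def)
  \<comment> \<open>The number of marks depends on the height only, so it multiplies both sides by the same factor.\<close>
  have ratio: "card {s \<in> marked_trees m ?V c 0. ht (fst s) 0 = j} * card {s \<in> marked_trees m ?W b 0. ht (fst s) 0 = i}
     \<le> card {s \<in> marked_trees m ?V c 0. ht (fst s) 0 = i} * card {s \<in> marked_trees m ?W b 0. ht (fst s) 0 = j}"
    if "i < j" for i j
  proof -
    have "card {T \<in> trees_of ?V c. ht T 0 = j} * card {T \<in> trees_of ?W b. ht T 0 = i}
      \<le> card {T \<in> trees_of ?V c. ht T 0 = i} * card {T \<in> trees_of ?W b. ht T 0 = j}"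
      using MN[OF that] by (simp add: M_def N_def flip: of_nat_mult)
    from mult_right_mono[OF this, of "card (weak_compositions m i) * card (weak_compositions m j)"]
    show ?thesis by (simp add: card_marked_trees_of_height mult_ac)
  qed
  have "map_pmf (\<lambda>s. real (ht (fst s) 0)) (pmf_of_set (marked_trees m ?V c 0))
    \<preceq>\<^sub>s\<^sub>t map_pmf (\<lambda>s. real (ht (fst s) 0)) (pmf_of_set (marked_trees m ?W b 0))"
    using assms by (intro stoch_le_of_likelihood_ratio ratio finite_marked_trees marked_trees_nonempty) auto
  then show ?thesis by (simp only: case_prod_unfold)
qed

end
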